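(* For any $\gamma\in\mathcal{U}$ lying in the orthogonal complement $(I^{\mathrm{kron}})^\perp$ (with respect to the bilinear form below), the power series $F^<_\gamma(\mathbf{x})$ is symmetric and \[ F^<_\gamma(\mathbf{x})=\sum_{\nu} s_\nu(\mathbf{x})\,\langle \mathfrak{J}_\nu(\mathbf{u}),\gamma\rangle, \] the sum over all partitions $\nu$.
   Context: Fix a positive integer $N$. Let $\mathcal{A}_\varnothing=\{1,\dots,N\}$ (unbarred letters), $\mathcal{A}_{\circ}=\{\bar 1,\dots,\bar N\}$ (barred letters), $\mathcal{A}=\mathcal{A}_\varnothing\sqcup\mathcal{A}_\circ$; colored words are finite words in $\mathcal{A}$. The natural order $<$ on $\mathcal{A}$ is $1<\bar1<2<\bar2<\cdots<N<\bar N$. $\mathcal{U}$ is the free associative $\mathbb{Z}$-algebra on noncommuting variables $u_x$ ($x\in\mathcal{A}$), whose monomials are identified with colored words. For $x\in\mathcal{A}$: $a{\Downarrow}=\overline{a-1}$ ($a\in\{2,\dots,N\}$), $\bar a{\Downarrow}=a$ ($1{\Downarrow}$ undefined). $I^{\mathrm{kron}}$ is the two-sided ideal generated by: $yyx-yxy$ ($x\in\mathcal{A}$, $y$ unbarred, $x<y$); $zyy-yzy$ ($z\in\mathcal{A}$, $y$ unbarred, $y<z$); $yyz-yzy$ ($z\in\mathcal{A}$, $y$ barred, $y<z$); $xyy-yxy$ ($x\in\mathcal{A}$, $y$ barred, $x<y$); $(xz-zx)y-y(xz-zx)$ for $x=y{\Downarrow}=z{\Downarrow}{\Downarrow}$;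 $xz-zx$ for $z{\Downarrow}{\Downarrow}$ defined and $x<z{\Downarrow}{\Downarrow}$. $\langle\cdot,\cdot\rangle$ is the symmetric bilinear form on $\mathcal{U}$ for which colored words form an orthonormal basis; $(I^{\mathrm{kron}})^\perp=\{\gamma\in\mathcal{U}:\langle f,\gamma\rangle=0\ \forall f\in I^{\mathrm{kron}}\}$, so $\langle\cdot,\gamma\rangle$ is well defined on $\mathcal{U}/I^{\mathrm{kron}}$. Write $y\succeq_{\mathrm{col}}x$ if $y>x$ or $x,y$ are equal barred letters. $e_k(\mathbf{u})=\sum_{z_1\succeq_{\mathrm{col}}\cdots\succeq_{\mathrm{col}}z_k}u_{z_1}\cdots u_{z_k}$ ($k\ge1$), $e_0=1$, $e_k=0$ for $k<0$; for a partition $\nu$ with $t=\nu_1$, $\mathfrak{J}_\nu(\mathbf{u})=\sum_{\pi\in S_t}\mathrm{sgn}(\pi)\prod_{i=1}^{t}e_{\nu'_i+\pi(i)-i}(\mathbf{u})$ (product in increasing $i$). For a colored word $w=w_1\cdots w_t$, $\mathrm{Des}_<(w)=\{i\in[t-1]: w_i>w_{i+1}\text{ or }w_i,w_{i+1}\text{ are equal barred letters}\}$. For $D\subseteq[t-1]$, $Q_D(\mathbf{x})=\sum x_{i_1}\cdots x_{i_t}$ over $1\le i_1\le\cdots\le i_t$ with $i_j<i_{j+1}$ whenever $j\in D$ (Gessel's fundamental quasisymmetric function). For $\gamma=\sum_w\gamma_w w\in\mathcal{U}$, $F^<_\gamma(\mathbf{x})=\sum_w\gamma_w Q_{\mathrm{Des}_<(w)}(\mathbf{x})$.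 $s_\nu$ denotes the Schur function. *)

theory Defs
  imports
    "HOL-Analysis.Infinite_Sum"
    "HOL-Combinatorics.Permutations"
    "HOL-Library.FuncSet"
    "HOL-Library.Poly_Mapping"
begin

section \<open>Colored letters\<close>

text \<open>Letters of arbitrary index; the alphabet of size \<open>N\<close> is carved out by \<open>alphabet N\<close> below.\<close>

datatype letter = Unbarred nat | Barred nat

fun barred :: "letter \<Rightarrow> bool" where
  "barred (Unbarred a) = False"
| "barred (Barred a) = True"

text \<open>The position of a letter in the natural order \<open>1 < 1' < 2 < 2' < \<dots>\<close>, where \<open>a'\<close> is the
  barred letter with index \<open>a\<close>.\<close>

fun letter_pos :: "letter \<Rightarrow> nat" where
  "letter_pos (Unbarred a) = 2 * a"
| "letter_pos (Barred a) = 2 * a + 1"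

lemma letter_pos_inject: "letter_pos x = letter_pos y \<Longrightarrow> x = y"
  by (cases x; cases y; simp; presburger)

instantiation letter :: linorder
begin

definition "x \<le> y \<longleftrightarrow> letter_pos x \<le> letter_pos y"
definition "x < y \<longleftrightarrow> letter_pos x < letter_pos y"

instance
  by standard (auto simp: less_eq_letter_def less_letter_def intro: letter_pos_inject)

end

definition alphabet :: "nat \<Rightarrow> letter set" where
  "alphabet N = Unbarred ` {1..N} \<union> Barred ` {1..N}"

fun down :: "letter \<Rightarrow> letter option" where
  "down (Unbarred a) = (if 2 \<le> a then Some (Barred (a - 1)) else None)"
| "down (Barred a) = Some (Unbarred a)"

definition down2 :: "letter \<Rightarrow> letter option" where
  "down2 z = Option.bind (down z) down"

definition col_ge :: "letter \<Rightarrow> letter \<Rightarrow> bool" where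
  "col_ge y x \<longleftrightarrow> y > x \<or> (y = x \<and> barred y)"


section \<open>The free associative algebra\<close>

text \<open>Under concatenation, lists form the free monoid, so that the convolution product of
  \<^theory>\<open>HOL-Library.Poly_Mapping\<close> makes finitely supported functions on words the free
  associative algebra.\<close>

instantiation list :: (type) monoid_add
begin

definition zero_list :: "'a list" where "zero_list = []"
definition plus_list :: "'a list \<Rightarrow> 'a list \<Rightarrow> 'a list" where "plus_list xs ys = xs @ ys"

instance
  by standard (simp_all add: zero_list_def plus_list_def)

end

type_synonym ncpoly = "letter list \<Rightarrow>\<^sub>0 int"

definition free_alg :: "nat \<Rightarrow> ncpoly set" where
  "free_alg N = {f. \<forall>w\<in>Poly_Mapping.keys f. set w \<subseteq> alphabet N}"

definition uvar :: "letter \<Rightarrow> ncpoly" where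
  "uvar x = Poly_Mapping.single [x] 1"

definition pairing :: "ncpoly \<Rightarrow> ncpoly \<Rightarrow> int" where
  "pairing f g = (\<Sum>w\<in>Poly_Mapping.keys f. Poly_Mapping.lookup f w * Poly_Mapping.lookup g w)"


section \<open>The Kronecker ideal\<close>

definition kron_generators :: "nat \<Rightarrow> ncpoly set" where
  "kron_generators N =
     {uvar y * uvar y * uvar x - uvar y * uvar x * uvar y | x y.
        x \<in> alphabet N \<and> y \<in> alphabet N \<and> \<not> barred y \<and> x < y}
   \<union> {uvar z * uvar y * uvar y - uvar y * uvar z * uvar y | z y.
        z \<in> alphabet N \<and> y \<in> alphabet N \<and> \<not> barred y \<and> y < z}
   \<union> {uvar y * uvar y * uvar z - uvar y * uvar z * uvar y | z y.
        z \<in> alphabet N \<and> y \<in> alphabet N \<and> barred y \<and> y < z}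
   \<union> {uvar x * uvar y * uvar y - uvar y * uvar x * uvar y | x y.
        x \<in> alphabet N \<and> y \<in> alphabet N \<and> barred y \<and> x < y}
   \<union> {(uvar x * uvar z - uvar z * uvar x) * uvar y - uvar y * (uvar x * uvar z - uvar z * uvar x) | x y z.
        x \<in> alphabet N \<and> y \<in> alphabet N \<and> z \<in> alphabet N \<and>
        down y = Some x \<and> down2 z = Some x}
   \<union> {uvar x * uvar z - uvar z * uvar x | x z.
        x \<in> alphabet N \<and> z \<in> alphabet N \<and> (\<exists>v. down2 z = Some v \<and> x < v)}"

inductive_set kron_ideal :: "nat \<Rightarrow> ncpoly set" for N :: nat where
  zero: "0 \<in> kron_ideal N"
| generator: "g \<in> kron_generators N \<Longrightarrow> g \<in> kron_ideal N"
| add: "f \<in> kron_ideal N \<Longrightarrow> g \<in> kron_ideal N \<Longrightarrow> f + g \<in> kron_ideal N"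
| uminus: "f \<in> kron_ideal N \<Longrightarrow> - f \<in> kron_ideal N"
| mult_left: "p \<in> free_alg N \<Longrightarrow> f \<in> kron_ideal N \<Longrightarrow> p * f \<in> kron_ideal N"
| mult_right: "f \<in> kron_ideal N \<Longrightarrow> p \<in> free_alg N \<Longrightarrow> f * p \<in> kron_ideal N"

definition kron_perp :: "nat \<Rightarrow> ncpoly set" where
  "kron_perp N = {\<gamma> \<in> free_alg N. \<forall>f\<in>kron_ideal N. pairing f \<gamma> = 0}"


section \<open>Partitions and noncommutative Schur functions\<close>

text \<open>A partition is the weakly decreasing list of its positive parts; \<open>conj_part \<nu> i\<close> is the
  \<open>i\<close>-th part of the conjugate partition (counting from 1).\<close>

definition partitions :: "nat list set" where
  "partitions = {\<nu>. sorted_wrt (\<ge>) \<nu> \<and> 0 \<notin> set \<nu>}"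

definition first_part :: "nat list \<Rightarrow> nat" where
  "first_part \<nu> = (if \<nu> = [] then 0 else hd \<nu>)"

definition conj_part :: "nat list \<Rightarrow> nat \<Rightarrow> nat" where
  "conj_part \<nu> i = card {r. r < length \<nu> \<and> i \<le> \<nu> ! r}"

text \<open>For \<open>k = 0\<close> the only summand is the empty product, so that \<open>nc_elem N 0 = 1\<close>.\<close>

definition nc_elem :: "nat \<Rightarrow> int \<Rightarrow> ncpoly" where
  "nc_elem N k =
     (if k < 0 then 0
      else \<Sum>zs | length zs = nat k \<and> set zs \<subseteq> alphabet N \<and> successively col_ge zs.
             prod_list (map uvar zs))"

text \<open>The factors do not commute: \<open>prod_list\<close> multiplies them in increasing order of \<open>i\<close>.\<close>

definition nc_schur :: "nat \<Rightarrow> nat list \<Rightarrow> ncpoly" where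
  "nc_schur N \<nu> =
     (\<Sum>\<pi> | \<pi> permutes {1..first_part \<nu>}.
        of_int (sign \<pi>) *
        prod_list (map (\<lambda>i. nc_elem N (int (conj_part \<nu> i) + int (\<pi> i) - int i))
                       [1..<Suc (first_part \<nu>)]))"


section \<open>Power series in infinitely many commuting variables\<close>

text \<open>A power series is given by its coefficients, indexed by exponent vectors. The variables
  \<open>x\<^sub>1, x\<^sub>2, \<dots>\<close> are indexed by \<^typ>\<open>nat\<close> starting from 0; only the order of the index set matters.\<close>

type_synonym power_series = "(nat \<Rightarrow>\<^sub>0 nat) \<Rightarrow> int"

definition symmetric_series :: "power_series \<Rightarrow> bool" where
  "symmetric_series F \<longleftrightarrow> (\<forall>\<sigma> m. bij \<sigma> \<longrightarrow> F (Poly_Mapping.map_key \<sigma> m) = F m)"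

text \<open>The fundamental quasisymmetric function of degree \<open>t\<close>: the coefficient of a monomial counts
  the index sequences giving rise to it. The elements of \<open>D\<close> are positions counted from 1, whereas
  list indices count from 0.\<close>

definition fundamental_qsym :: "nat \<Rightarrow> nat set \<Rightarrow> power_series" where
  "fundamental_qsym t D m =
     int (card {is. length is = t \<and> sorted is \<and> (\<forall>j\<in>D. is ! (j - 1) < is ! j) \<and>
                    sum_list (map (\<lambda>i. Poly_Mapping.single i 1) is) = m})"

definition Des :: "letter list \<Rightarrow> nat set" where
  "Des w = {i. 1 \<le> i \<and> i < length w \<and>
               (w ! (i - 1) > w ! i \<or> (w ! (i - 1) = w ! i \<and> barred (w ! i)))}"

definition F_series :: "ncpoly \<Rightarrow> power_series" where
  "F_series \<gamma> m = (\<Sum>w\<in>Poly_Mapping.keys \<gamma>. Poly_Mapping.lookup \<gamma> w * fundamental_qsym (length w) (Des w) m)"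

text \<open>Schur functions as generating functions of semistandard Young tableaux.\<close>

definition diagram :: "nat list \<Rightarrow> (nat \<times> nat) set" where
  "diagram \<nu> = {(r, c). r < length \<nu> \<and> c < \<nu> ! r}"

definition ssyt :: "nat list \<Rightarrow> (nat \<times> nat \<Rightarrow> nat) set" where
  "ssyt \<nu> = {T \<in> diagram \<nu> \<rightarrow>\<^sub>E UNIV.
     (\<forall>r c c'. (r, c) \<in> diagram \<nu> \<and> (r, c') \<in> diagram \<nu> \<and> c < c' \<longrightarrow> T (r, c) \<le> T (r, c')) \<and>
     (\<forall>r r' c. (r, c) \<in> diagram \<nu> \<and> (r', c) \<in> diagram \<nu> \<and> r < r' \<longrightarrow> T (r, c) < T (r', c))}"

definition schur :: "nat list \<Rightarrow> power_series" where
  "schur \<nu> m = int (card {T \<in> ssyt \<nu>. (\<Sum>b\<in>diagram \<nu>. Poly_Mapping.single (T b) 1) = m})"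

end

theory Submission
  imports Defs
    "HOL-Computational_Algebra.Formal_Power_Series"
    "Jordan_Normal_Form.Determinant"
begin

text \<open>
  The generating function \<open>E(s)\<close> of the \<open>e\<^sub>k(u)\<close> is the product of the factors \<open>1 + s u\<close> (unbarred
  letters) and \<open>(1 - s u)\<close> inverse (barred letters) in decreasing order of the letters. If \<open>E(s)\<close>
  is the product over the letters below \<open>y\<close>, the Kronecker relations give
  \<open>[E(s), y] = s C E(s)\<close>, where \<open>C\<close> is the sum of the brackets \<open>[x, y]\<close> over the lower letters \<open>x\<close>,
  and \<open>y C = 0\<close> or \<open>C y = 0\<close> according to whether \<open>y\<close> is unbarred or barred. Hence
  \<open>E(s)\<close> and \<open>E(t)\<close> commute by induction on the letters. For a barred \<open>y\<close> one uses that
  \<open>(1 - s t C) (1 - t y) (1 - s y)\<close> multiplies the product of the two generating functions that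
  include \<open>y\<close> to \<open>E(s) E(t)\<close>.

  So the \<open>e\<^sub>k(u)\<close> modulo the ideal are the values of a homomorphism from a polynomial ring in
  commuting variables. There the sums \<open>h\<^sub>k\<close> over words without descents are the complete symmetric
  functions dual to the \<open>e\<^sub>k\<close>, and the coefficient of \<open>F\<^sub>\<gamma>\<close> at a monomial is the pairing of \<open>\<gamma>\<close> with a
  product of the \<open>h\<^sub>k\<close>. The Pieri rule for the Jacobi--Trudi determinants in the \<open>e\<^sub>k\<close>, applied once
  for each variable, expands this product in terms of semistandard tableaux.
\<close>

section \<open>Commuting generating functions\<close>

text \<open>Commutation of \<open>E(s)\<close> and \<open>E(t)\<close> involves two independent
  parameters. The induction therefore runs in an arbitrary ring with central \<open>s\<close> and
  \<open>t\<close>; it is then applied to power series in two variables, where comparing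
  coefficients separates e_k from e_l. Barred letters are the obstacle: their factors are inverses,
  and multiplying them away leaves an equation \<open>(1 - s t C) v = 0\<close>. In a general ring
  this says little, but for formal \<open>s\<close> and \<open>t\<close> it forces
  \<open>v = 0\<close>. A second obstacle is that the quotient by the ideal is a noncommutative
  ring, in which no determinant calculus is available. Determinants are therefore manipulated over
  integer polynomials, an integral domain, and only the finished expansion is evaluated in the
  quotient. Symmetry has the same source: in the polynomial ring the product of the h_k ignores the
  order of the variables.\<close>

primrec descending_prod :: "(nat \<Rightarrow> 'a::monoid_mult) \<Rightarrow> nat \<Rightarrow> 'a" where
  "descending_prod g 0 = 1"
| "descending_prod g (Suc n) = g n * descending_prod g n"

text \<open>Letters are encoded by their positions: even ones are unbarred, odd ones barred. A
  barred factor is specified only as a two-sided inverse, which makes sense in any ring; over power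
  series it is the geometric series.\<close>

definition letter_factor :: "'a::ring_1 \<Rightarrow> (nat \<Rightarrow> 'a) \<Rightarrow> (nat \<Rightarrow> 'a) \<Rightarrow> bool" where
  "letter_factor s u g \<longleftrightarrow>
     (\<forall>x. s * x = x * s) \<and>
     (\<forall>n. if even n then g n = 1 + s * u n
          else g n * (1 - s * u n) = 1 \<and> (1 - s * u n) * g n = 1)"

lemma letter_factorD:
  assumes "letter_factor s u g"
  shows letter_factor_central: "s * x = x * s"
    and letter_factor_even: "even n \<Longrightarrow> g n = 1 + s * u n"
    and letter_factor_odd: "odd n \<Longrightarrow> g n * (1 - s * u n) = 1" "odd n \<Longrightarrow> (1 - s * u n) * g n = 1"
  using assms unfolding letter_factor_def by metis+

lemma inverse_commute:
  fixes g p x :: "'a::ring_1"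
  assumes "g * p = 1" "p * g = 1" "p * x = x * p"
  shows "g * x = x * g"
proof -
  have "g * x = g * x * (p * g)" using assms by simp
  also have "\<dots> = g * (p * x) * g" by (simp only: assms(3) mult.assoc)
  also have "\<dots> = x * g" using assms(1) by (simp flip: mult.assoc)
  finally show ?thesis .
qed

text \<open>The generators of the ideal, read as statements about brackets [u_i, u_j] with i < j.
  Each endpoint annihilates the bracket from one side, which is determined by the endpoint's colour
  and by whether it is the upper or the lower one. The ring is left arbitrary so that the same facts
  apply to power series.\<close>

locale kron_letters =
  fixes u :: "nat \<Rightarrow> 'a::ring_1"
  assumes even_lower: "even j \<Longrightarrow> i < j \<Longrightarrow> u j * (u i * u j - u j * u i) = 0"
    and even_upper: "even i \<Longrightarrow> i < j \<Longrightarrow> (u i * u j - u j * u i) * u i = 0"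
    and odd_upper: "odd i \<Longrightarrow> i < j \<Longrightarrow> u i * (u i * u j - u j * u i) = 0"
    and odd_lower: "odd j \<Longrightarrow> i < j \<Longrightarrow> (u i * u j - u j * u i) * u j = 0"
    and triple: "(u i * u (i + 2) - u (i + 2) * u i) * u (i + 1) =
                 u (i + 1) * (u i * u (i + 2) - u (i + 2) * u i)"
    and far: "i + 3 \<le> j \<Longrightarrow> u i * u j = u j * u i"
begin

definition bracket :: "nat \<Rightarrow> nat \<Rightarrow> 'a" where
  "bracket i j = u i * u j - u j * u i"

definition lower_bracket :: "nat \<Rightarrow> nat \<Rightarrow> 'a" where
  "lower_bracket m n = (\<Sum>i<m. bracket i n)"

lemma factor_commutes:
  assumes "letter_factor s u g" "x * u m = u m * x"
  shows "g m * x = x * g m"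
proof -
  have s: "s * y = y * s" for y using letter_factorD[OF assms(1)] by blast
  have sx: "s * u m * x = x * (s * u m)"
    by (metis s assms(2) mult.assoc)
  show ?thesis
  proof (cases "even m")
    case True
    then have "g m = 1 + s * u m" using letter_factorD[OF assms(1)] by blast
    then show ?thesis using sx by (simp add: algebra_simps)
  next
    case False
    then have "g m * (1 - s * u m) = 1" "(1 - s * u m) * g m = 1"
      using letter_factor_odd[OF assms(1)] by simp_all
    then show ?thesis
      by (rule inverse_commute) (use sx in \<open>simp add: algebra_simps\<close>)
  qed
qed

text \<open>Multiplying the bracket by an unbarred factor from the right changes nothing, because
  \<open>bracket i n * u i = 0\<close>. A barred factor fixes the bracket from the left, because
  \<open>u i * bracket i n = 0\<close>.\<close>

lemma factor_commutator:
  assumes "letter_factor s u g" "i < n"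
  shows "g i * u n - u n * g i = s * bracket i n * g i"
proof -
  have s: "s * y = y * s" for y using letter_factorD[OF assms(1)] by blast
  show ?thesis
  proof (cases "even i")
    case True
    then have g: "g i = 1 + s * u i" using letter_factorD[OF assms(1)] by blast
    have "bracket i n * u i = 0" using even_upper[OF True assms(2)] by (simp add: bracket_def)
    then have "s * bracket i n * (s * u i) = 0" by (metis s mult.assoc mult_zero_left mult_zero_right)
    moreover have "u n * (s * u i) = s * (u n * u i)" by (metis s mult.assoc)
    ultimately show ?thesis unfolding g by (simp add: algebra_simps bracket_def)
  next
    case False
    define p where "p = 1 - s * u i"
    have gp: "g i * p = 1" "p * g i = 1"
      using letter_factor_odd[OF assms(1) False] by (simp_all add: p_def)
    have "u i * bracket i n = 0" using odd_upper[OF False assms(2)] by (simp add: bracket_def)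
    then have "p * bracket i n = bracket i n" by (simp add: p_def algebra_simps)
    then have gD: "g i * bracket i n = bracket i n" by (metis gp(1) mult.assoc mult_1_left)
    have "u n * (s * u i) = s * (u n * u i)" by (metis s mult.assoc)
    then have y: "u n * p - p * u n = s * bracket i n" unfolding p_def bracket_def by (simp add: algebra_simps)
    have "g i * u n - u n * g i = g i * u n * (p * g i) - (g i * p) * u n * g i"
      using gp by simp
    also have "\<dots> = g i * (u n * p - p * u n) * g i" by (simp add: algebra_simps)
    also have "\<dots> = s * (g i * bracket i n) * g i" unfolding y by (metis s mult.assoc)
    finally show ?thesis using gD by simp
  qed
qed

lemma bracket_far: "i + 3 \<le> n \<Longrightarrow> bracket i n = 0"
  using far by (simp add: bracket_def)

text \<open>Brackets at distance three or more vanish. A surviving term with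
  \<open>i < m < n\<close> has \<open>i = n - 2\<close> and \<open>m = n - 1\<close>, which is
  exactly the situation of \<open>triple\<close>.\<close>

lemma lower_bracket_commutes:
  assumes "m < n" shows "lower_bracket m n * u m = u m * lower_bracket m n"
proof -
  have "bracket i n * u m = u m * bracket i n" if "i < m" for i
  proof (cases "i + 3 \<le> n")
    case False
    then have "n = i + 2" "m = i + 1" using that assms by auto
    then show ?thesis using triple by (simp add: bracket_def)
  qed (simp add: bracket_far)
  then show ?thesis by (simp add: lower_bracket_def sum_distrib_left sum_distrib_right)
qed

text \<open>Each new factor contributes its own bracket, and the brackets already collected are
  pulled in front of it by \<open>lower_bracket_commutes\<close>. The number \<open>m\<close> of
  factors is kept apart from \<open>n\<close> so that the induction can run with \<open>n\<close>
  fixed.\<close>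

lemma descending_prod_commutator:
  assumes "letter_factor s u g" "m \<le> n"
  shows "descending_prod g m * u n - u n * descending_prod g m = s * lower_bracket m n * descending_prod g m"
  using assms(2)
proof (induction m)
  case (Suc m)
  have s: "s * y = y * s" for y using letter_factorD[OF assms(1)] by blast
  let ?E = "descending_prod g m"
  have "g m * ?E * u n - u n * (g m * ?E) =
        (g m * u n - u n * g m) * ?E + g m * (?E * u n - u n * ?E)"
    by (simp add: algebra_simps)
  also have "\<dots> = s * bracket m n * g m * ?E + g m * (s * lower_bracket m n * ?E)"
    using Suc factor_commutator[OF assms(1), of m n] by simp
  also have "g m * (s * lower_bracket m n * ?E) = s * (g m * lower_bracket m n) * ?E" by (metis s mult.assoc)
  also have "g m * lower_bracket m n = lower_bracket m n * g m"
    using factor_commutes[OF assms(1) lower_bracket_commutes] Suc.prems by simp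
  finally show ?case by (simp add: lower_bracket_def algebra_simps)
qed (simp add: lower_bracket_def)

lemma lower_bracket_even: "even n \<Longrightarrow> u n * lower_bracket m n = 0" if "m \<le> n"
  using that even_lower[of n] by (simp add: lower_bracket_def bracket_def sum_distrib_left)

lemma lower_bracket_odd: "odd n \<Longrightarrow> lower_bracket m n * u n = 0" if "m \<le> n"
  using that odd_lower[of n] by (simp add: lower_bracket_def bracket_def sum_distrib_right)

text \<open>The hypothesis \<open>cancel\<close> says that left multiplication by
  \<open>1 - s * t * c\<close> is injective. It replaces invertibility of this element and enters
  only for barred letters.\<close>

lemma descending_prods_commute:
  assumes g: "letter_factor s u g" and h: "letter_factor t u h"
    and cancel: "\<And>c v. v = s * t * c * v \<Longrightarrow> v = 0"
  shows "descending_prod g n * descending_prod h n = descending_prod h n * descending_prod g n"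
proof (induction n)
  case (Suc n)
  have s: "s * y = y * s" for y by (rule letter_factor_central[OF g])
  have t: "t * y = y * t" for y by (rule letter_factor_central[OF h])
  define E F y c where "E = descending_prod g n" "F = descending_prod h n" "y = u n" "c = lower_bracket n n"
  note defs = this
  have IH: "E * F = F * E" using Suc by (simp add: defs)
  have E: "E * y = y * E + s * c * E"
    using descending_prod_commutator[OF g, of n n] by (simp add: defs algebra_simps)
  have F: "F * y = y * F + t * c * F"
    using descending_prod_commutator[OF h, of n n] by (simp add: defs algebra_simps)
  have "g n * E * (h n * F) = h n * F * (g n * E)"
  proof (cases "even n")
    case True
    then have gh: "g n = 1 + s * y" "h n = 1 + t * y"
      using letter_factor_even[OF g True] letter_factor_even[OF h True] by (simp_all add: defs)
    have yc: "y * c = 0" using lower_bracket_even[OF _ True, of n] by (simp add: defs)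
    \<comment> \<open>Moving \<open>E'\<close> past \<open>1 + b * y\<close> leaves the term
      \<open>b * a * c * E'\<close>, which \<open>1 + a * y\<close> fixes because
      \<open>y * c = 0\<close>. The resulting coefficient of \<open>E' * F'\<close> is symmetric
      under exchanging the two parameters.\<close>
    have *: "(1 + a * y) * E' * ((1 + b * y) * F') = ((1 + a * y) * (1 + b * y) + a * b * c) * E' * F'"
      if a: "\<And>x. a * x = x * a" and b: "\<And>x. b * x = x * b" and E': "E' * y = y * E' + a * c * E'"
      for a b E' F'
    proof -
      have "E' * (1 + b * y) = (1 + b * y) * E' + b * a * c * E'"
      proof -
        have "E' * (b * y) = b * (E' * y)" by (metis b mult.assoc)
        then show ?thesis unfolding E' by (simp add: algebra_simps)
      qed
      moreover have "(1 + a * y) * (b * a * c) = a * b * c"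
      proof -
        have "a * y * (b * a * c) = a * b * a * (y * c)" by (metis a b mult.assoc)
        then show ?thesis using yc a[of b] by (simp add: algebra_simps)
      qed
      ultimately have "(1 + a * y) * (E' * (1 + b * y)) = ((1 + a * y) * (1 + b * y) + a * b * c) * E'"
        by (simp add: distrib_left distrib_right flip: mult.assoc)
      then show ?thesis by (metis mult.assoc)
    qed
    have "(1 + s * y) * (1 + t * y) = (1 + t * y) * (1 + s * y)"
    proof -
      have "s * y * (t * y) = t * y * (s * y)" by (metis s t mult.assoc)
      then show ?thesis by (simp add: algebra_simps)
    qed
    moreover have "s * t = t * s" by (rule s)
    ultimately show ?thesis
      unfolding gh *[OF s t E] *[OF t s F] by (simp add: mult.assoc IH)
  next
    case False
    define p q where pq: "p = 1 - s * y" "q = 1 - t * y"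
    have gp: "g n * p = 1" "p * g n = 1" and hq: "h n * q = 1" "q * h n = 1"
      using letter_factor_odd[OF g False] letter_factor_odd[OF h False] by (simp_all add: defs pq)
    have cy: "c * y = 0" using lower_bracket_odd[OF _ False, of n] by (simp add: defs)
    have pqc: "p * q = q * p"
    proof -
      have "s * y * (t * y) = t * y * (s * y)" by (metis s t mult.assoc)
      then show ?thesis unfolding pq by (simp add: algebra_simps)
    qed
    define W where "W = (1 - s * t * c) * q * p"
    \<comment> \<open>Since \<open>c * y = 0\<close>, the product of \<open>1 - a * b * c\<close>
      and \<open>1 - b * y\<close> is \<open>1 - b * y - a * b * c\<close>, and this times
      \<open>E'\<close> equals \<open>E' * (1 - b * y)\<close>. So the multiplier removes first
      \<open>g'\<close> and then \<open>h'\<close>.\<close>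
    have *: "(1 - a * b * c) * (1 - b * y) * (1 - a * y) * (g' * E' * (h' * F')) = E' * F'"
      if a: "\<And>x. a * x = x * a" and b: "\<And>x. b * x = x * b" and E': "E' * y = y * E' + a * c * E'"
        and g': "(1 - a * y) * g' = 1" and h': "(1 - b * y) * h' = 1"
      for a b E' F' g' h'
    proof -
      have "E' * (b * y) = b * (E' * y)" "a * b * c * (b * y) = a * b * b * (c * y)" by (metis b mult.assoc)+
      then have "(1 - a * b * c) * (1 - b * y) * E' = E' * (1 - b * y)"
        using a[of b] cy by (simp add: algebra_simps E')
      then have "(1 - a * b * c) * (1 - b * y) * E' * h' = E'" using h' by (simp add: mult.assoc)
      then show ?thesis
        by (metis g' mult.assoc mult_1_left)
    qed
    have 1: "W * (g n * E * (h n * F)) = E * F"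
      unfolding W_def using *[OF s t E] gp hq by (simp add: pq)
    have 2: "W * (h n * F * (g n * E)) = E * F"
      unfolding W_def mult.assoc[of _ q p] pqc[symmetric] using *[OF t s F] gp hq s[of t] IH
      by (simp add: pq flip: mult.assoc)
    \<comment> \<open>\<open>W\<close> sends both products to \<open>E * F\<close>. Applying only
      the part \<open>q * p\<close> of it to their difference isolates the factor
      \<open>1 - s * t * c\<close> for \<open>cancel\<close>; afterwards \<open>q * p\<close> is
      undone by \<open>h n\<close> and \<open>g n\<close>.\<close>
    define v where "v = q * p * (g n * E * (h n * F) - h n * F * (g n * E))"
    have "(1 - s * t * c) * v = 0"
      using 1 2 unfolding v_def W_def by (simp add: mult.assoc right_diff_distrib)
    then have "v = s * t * c * v" by (simp add: algebra_simps)
    then have v: "v = 0" by (rule cancel)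
    have "g n * E * (h n * F) - h n * F * (g n * E) = g n * (h n * v)"
      unfolding v_def by (metis gp(1) hq(1) mult.assoc mult_1_left)
    then show ?thesis using v by simp
  qed
  then show ?case by (simp add: defs)
qed simp

end

section \<open>Power series in two central variables\<close>

unbundle fps_syntax

lemma kron_letters_fps_const: "kron_letters u \<Longrightarrow> kron_letters (\<lambda>n. fps_const (u n))"
  unfolding kron_letters_def by simp metis

lemma letter_factor_fps_const:
  assumes "letter_factor fps_X (\<lambda>n. fps_const (u n)) g"
  shows "letter_factor (fps_const fps_X) (\<lambda>n. fps_const (fps_const (u n))) (\<lambda>n. fps_const (g n))"
proof -
  note g = letter_factorD[OF assms]
  have 1: "1 + fps_const y = fps_const (1 + y)" "1 - fps_const y = fps_const (1 - y)" for y :: "'a fps"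
    by (auto simp: fps_eq_iff)
  show ?thesis
    unfolding letter_factor_def
  proof (intro conjI allI)
    fix x :: "'a fps fps"
    show "fps_const fps_X * x = x * fps_const fps_X"
      by (rule fps_ext) (simp add: fps_mult_fps_X_commute)
  next
    fix n
    show "if even n then fps_const (g n) = 1 + fps_const fps_X * fps_const (fps_const (u n))
      else fps_const (g n) * (1 - fps_const fps_X * fps_const (fps_const (u n))) = 1 \<and>
        (1 - fps_const fps_X * fps_const (fps_const (u n))) * fps_const (g n) = 1"
      using g(2)[of n] g(3,4)[of n] by (simp add: 1)
  qed
qed

text \<open>Writes a series in the outer of two variables, whereas \<open>fps_const\<close> writes
  it in the inner one.\<close>

definition fps_lift :: "'a::ring_1 fps \<Rightarrow> 'a fps fps" where
  "fps_lift f = Abs_fps (\<lambda>n. fps_const (f $ n))"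

lemma fps_lift_nth [simp]: "fps_lift f $ n = fps_const (f $ n)"
  by (simp add: fps_lift_def)

lemma sum_fps_const: "(\<Sum>i\<in>A. fps_const (f i)) = fps_const (\<Sum>i\<in>A. f i)"
  by (induction A rule: infinite_finite_induct) auto

lemma fps_lift_hom:
  "fps_lift (f * g) = fps_lift f * fps_lift g"
  "fps_lift (f + g) = fps_lift f + fps_lift g"
  "fps_lift (f - g) = fps_lift f - fps_lift g"
  "fps_lift 1 = 1"
  "fps_lift fps_X = fps_X"
  "fps_lift (fps_const c) = fps_const (fps_const c)"
  by (simp_all add: fps_eq_iff fps_mult_nth sum_fps_const fps_X_def)

lemma letter_factor_fps_lift:
  assumes "letter_factor fps_X (\<lambda>n. fps_const (u n)) g"
  shows "letter_factor fps_X (\<lambda>n. fps_const (fps_const (u n))) (\<lambda>n. fps_lift (g n))"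
proof -
  note g = letter_factorD[OF assms]
  show ?thesis
    unfolding letter_factor_def
  proof (intro conjI allI)
    fix n
    show "if even n then fps_lift (g n) = 1 + fps_X * fps_const (fps_const (u n))
      else fps_lift (g n) * (1 - fps_X * fps_const (fps_const (u n))) = 1 \<and>
        (1 - fps_X * fps_const (fps_const (u n))) * fps_lift (g n) = 1"
      using g(2)[of n] g(3,4)[of n, THEN arg_cong[where f = fps_lift]]
      by (simp add: fps_lift_hom)
  qed (simp add: fps_mult_fps_X_commute)
qed

text \<open>Each coefficient of \<open>v\<close> is a combination of strictly lower ones, so all of
  them vanish. This is the cancellation that barred letters require.\<close>

lemma fps_X_cancel:
  fixes v :: "'a::ring_1 fps"
  assumes "v = fps_X * (c * v)" shows "v = 0"
proof -
  have "v $ n = 0" for n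
  proof (induction n rule: less_induct)
    case (less n)
    have "v $ n = (fps_X * (c * v)) $ n" using assms by simp
    also have "\<dots> = 0"
    proof (cases n)
      case (Suc m)
      then have "(\<Sum>i=0..m. c $ i * v $ (m - i)) = 0" using less by (intro sum.neutral) auto
      then show ?thesis using Suc by (simp add: fps_mult_nth[of c])
    qed simp
    finally show ?case .
  qed
  then show ?thesis by (simp add: fps_eq_iff)
qed

lemma descending_prod_hom:
  assumes "f 1 = 1" "\<And>x y. f (x * y) = f x * f y"
  shows "descending_prod (\<lambda>n. f (g n)) n = f (descending_prod g n)"
  using assms by (induction n) auto

text \<open>In the product of \<open>fps_const E\<close> and \<open>fps_lift E\<close> the inner
  exponent \<open>k\<close> comes only from the first factor and the outer exponent \<open>l\<close>
  only from the second, so each coefficient is a single product of coefficients of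
  \<open>E\<close>.\<close>

lemma (in kron_letters) descending_prod_nth_commute:
  assumes g: "letter_factor fps_X (\<lambda>n. fps_const (u n)) g"
  shows "descending_prod g n $ k * descending_prod g n $ l =
         descending_prod g n $ l * descending_prod g n $ k"
proof -
  let ?E = "descending_prod g n"
  interpret P: kron_letters "\<lambda>n. fps_const (fps_const (u n))"
    by (intro kron_letters_fps_const kron_letters_axioms)
  have "descending_prod (\<lambda>n. fps_const (g n)) n * descending_prod (\<lambda>n. fps_lift (g n)) n =
        descending_prod (\<lambda>n. fps_lift (g n)) n * descending_prod (\<lambda>n. fps_const (g n)) n"
  proof (rule P.descending_prods_commute)
    fix c v :: "'a fps fps"
    assume "v = fps_const fps_X * fps_X * c * v"
    then have "v = fps_X * ((fps_const fps_X * c) * v)"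
      by (metis fps_mult_fps_X_commute mult.assoc)
    then show "v = 0" by (rule fps_X_cancel)
  qed (use g letter_factor_fps_const letter_factor_fps_lift in blast)+
  then have "fps_const ?E * fps_lift ?E = fps_lift ?E * fps_const ?E"
    by (simp add: descending_prod_hom fps_lift_hom)
  then have "(fps_const ?E * fps_lift ?E) $ l $ k = (fps_lift ?E * fps_const ?E) $ l $ k"
    by simp
  then show ?thesis by simp
qed

section \<open>Word sums and their generating functions\<close>

definition chain_sum :: "('b \<Rightarrow> 'b \<Rightarrow> bool) \<Rightarrow> 'b set \<Rightarrow> ('b \<Rightarrow> 'a::ring_1) \<Rightarrow> nat \<Rightarrow> 'a" where
  "chain_sum R A v k =
     (\<Sum>zs | length zs = k \<and> set zs \<subseteq> A \<and> successively R zs. prod_list (map v zs))"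

lemma finite_words: "finite A \<Longrightarrow> finite {zs. length zs = k \<and> set zs \<subseteq> A \<and> P zs}"
  by (rule finite_subset[OF _ finite_lists_length_eq[of A k]]) auto

lemma chain_sum_0 [simp]: "chain_sum R A v 0 = 1"
proof -
  have "{zs. length zs = 0 \<and> set zs \<subseteq> A \<and> successively R zs} = {[]}" by auto
  then show ?thesis by (simp add: chain_sum_def)
qed

lemma col_ge_trans: "col_ge x y \<Longrightarrow> col_ge y z \<Longrightarrow> col_ge x z"
  by (auto simp: col_ge_def)

text \<open>Chains weakly decrease, so the largest letter occurs only in an initial block. Once a
  leading \<open>y\<close> is split off, another \<open>y\<close> may follow only if
  \<open>y\<close> is barred.\<close>

lemma chain_sum_col_ge_insert:
  assumes "finite A" "\<And>x. x \<in> A \<Longrightarrow> x < y"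
  shows "chain_sum col_ge (insert y A) v (Suc k) =
    v y * chain_sum col_ge (if barred y then insert y A else A) v k + chain_sum col_ge A v (Suc k)"
proof -
  let ?B = "if barred y then insert y A else A"
  let ?W = "\<lambda>A k. {zs. length zs = k \<and> set zs \<subseteq> A \<and> successively col_ge zs}"
  have succ: "successively col_ge zs \<longleftrightarrow> sorted_wrt col_ge zs" for zs
    by (intro successively_iff_sorted_wrt_strong) (blast intro: col_ge_trans)
  have ge: "col_ge y x \<longleftrightarrow> x \<in> ?B" if "x \<in> insert y A" for x
    using that assms(2) by (auto simp: col_ge_def)
  have B: "?B \<subseteq> insert y A" by auto
  have "zs \<in> ?W (insert y A) (Suc k) \<longleftrightarrow> zs \<in> (#) y ` ?W ?B k \<union> ?W A (Suc k)" for zs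
  proof (cases zs)
    case (Cons z ws)
    show ?thesis
    proof (cases "z = y")
      case True
      have "y \<notin> A" using assms(2) by blast
      have "set ws \<subseteq> insert y A \<and> (\<forall>x\<in>set ws. col_ge y x) \<longleftrightarrow> set ws \<subseteq> ?B"
        using ge B by blast
      then show ?thesis using True Cons \<open>y \<notin> A\<close> unfolding succ by auto
    next
      case False
      have "set ws \<subseteq> A" if "set ws \<subseteq> insert y A" "\<forall>x\<in>set ws. col_ge z x" "z \<in> A"
        using that assms(2)[of z] by (force simp: col_ge_def)
      then show ?thesis using False Cons unfolding succ by auto
    qed
  qed auto
  then have W: "?W (insert y A) (Suc k) = (#) y ` ?W ?B k \<union> ?W A (Suc k)" by blast
  have "y \<notin> A" using assms(2) by blast
  then have "chain_sum col_ge (insert y A) v (Suc k) =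
      (\<Sum>zs\<in>(#) y ` ?W ?B k. prod_list (map v zs)) + (\<Sum>zs\<in>?W A (Suc k). prod_list (map v zs))"
    unfolding chain_sum_def W using assms(1)
    by (intro sum.union_disjoint finite_imageI finite_words) auto
  also have "(\<Sum>zs\<in>(#) y ` ?W ?B k. prod_list (map v zs)) = v y * chain_sum col_ge ?B v k"
    unfolding chain_sum_def by (subst sum.reindex) (auto simp: sum_distrib_left)
  finally show ?thesis by (simp add: chain_sum_def)
qed

definition letters_below :: "nat \<Rightarrow> nat \<Rightarrow> letter set" where
  "letters_below N n = {x \<in> alphabet N. letter_pos x < n}"

definition letter_at :: "nat \<Rightarrow> letter" where
  "letter_at n = (if even n then Unbarred (n div 2) else Barred (n div 2))"

lemma letter_pos_letter_at [simp]: "letter_pos (letter_at n) = n"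
  by (auto simp: letter_at_def)

lemma letter_at_letter_pos [simp]: "letter_at (letter_pos x) = x"
  by (rule letter_pos_inject) simp

lemma barred_letter_at [simp]: "barred (letter_at n) \<longleftrightarrow> odd n"
  by (simp add: letter_at_def)

lemma alphabet_iff: "x \<in> alphabet N \<longleftrightarrow> 2 \<le> letter_pos x \<and> letter_pos x < 2 * N + 2"
  by (cases x) (auto simp: alphabet_def)

lemma finite_alphabet [simp]: "finite (alphabet N)"
  by (simp add: alphabet_def)

lemma letters_below_Suc:
  "letters_below N (Suc n) =
     (if letter_at n \<in> alphabet N then insert (letter_at n) (letters_below N n) else letters_below N n)"
proof -
  have "letter_pos x = n \<longleftrightarrow> x = letter_at n" for x by (metis letter_at_letter_pos letter_pos_letter_at)
  then show ?thesis by (auto simp: letters_below_def less_Suc_eq)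
qed

text \<open>The value 0 off the alphabet makes every bracket with such a position vanish and its
  factor equal to 1, so that the relations can be stated for all positions.\<close>

definition letter_value :: "nat \<Rightarrow> (letter \<Rightarrow> 'a::zero) \<Rightarrow> nat \<Rightarrow> 'a" where
  "letter_value N v n = (if letter_at n \<in> alphabet N then v (letter_at n) else 0)"

text \<open>For an unbarred letter the recursion that adds the largest letter is multiplication of
  the generating function by \<open>1 + X u\<close>. For a barred letter it says that
  \<open>1 - X u\<close> times the new function is the old one. The largest position in the alphabet
  is \<open>2 * N + 1\<close>.\<close>

lemma chain_sums_commute:
  fixes v :: "letter \<Rightarrow> 'a::ring_1"
  assumes "kron_letters (letter_value N v)"
  shows "chain_sum col_ge (alphabet N) v k * chain_sum col_ge (alphabet N) v l =
         chain_sum col_ge (alphabet N) v l * chain_sum col_ge (alphabet N) v k"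
proof -
  interpret kron_letters "letter_value N v" by fact
  let ?u = "letter_value N v"
  define E where "E n = Abs_fps (chain_sum col_ge (letters_below N n) v)" for n
  define g where "g n = (if even n then 1 + fps_X * fps_const (?u n) else Abs_fps (\<lambda>k. ?u n ^ k))" for n
  have inv: "Abs_fps (\<lambda>k. x ^ k) * (1 - fps_X * fps_const x) = 1"
      "(1 - fps_X * fps_const x) * Abs_fps (\<lambda>k. x ^ k) = 1" for x :: 'a
  proof -
    show 1: "(1 - fps_X * fps_const x) * Abs_fps (\<lambda>k. x ^ k) = 1"
      by (rule fps_ext, case_tac n) (auto simp: left_diff_distrib mult.assoc)
    have "Abs_fps (\<lambda>k. x ^ k) * (fps_X * fps_const x) = fps_X * (Abs_fps (\<lambda>k. x ^ k) * fps_const x)"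
      by (metis fps_mult_fps_X_commute mult.assoc)
    then show "Abs_fps (\<lambda>k. x ^ k) * (1 - fps_X * fps_const x) = 1"
      by (intro fps_ext, case_tac n) (auto simp: right_diff_distrib power_commutes)
  qed
  have g: "letter_factor fps_X (\<lambda>n. fps_const (?u n)) g"
    using inv by (auto simp: letter_factor_def g_def fps_mult_fps_X_commute)
  have step: "E (Suc n) = g n * E n" for n
  proof (cases "letter_at n \<in> alphabet N")
    case False
    then have "g n = 1" by (auto simp: g_def letter_value_def fps_eq_iff power_0_left)
    with False show ?thesis by (simp add: E_def letters_below_Suc)
  next
    case True
    have rec: "chain_sum col_ge (letters_below N (Suc n)) v (Suc k) =
        ?u n * chain_sum col_ge (letters_below N (if odd n then Suc n else n)) v k +
        chain_sum col_ge (letters_below N n) v (Suc k)" for k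
      using True chain_sum_col_ge_insert[of "letters_below N n" "letter_at n" v k]
      by (simp add: letters_below_Suc letter_value_def) 
         (auto simp: letters_below_def less_letter_def)
    show ?thesis
    proof (cases "even n")
      case True
      then show ?thesis using rec
        by (intro fps_ext, case_tac na) (auto simp: E_def g_def distrib_right mult.assoc)
    next
      case False
      then have "(1 - fps_X * fps_const (?u n)) * E (Suc n) = E n" using rec
        by (intro fps_ext, case_tac na) (auto simp: E_def left_diff_distrib mult.assoc)
      then show ?thesis using inv(1)[of "?u n"] False by (metis g_def mult.assoc mult_1_left)
    qed
  qed
  have "E 0 = 1"
  proof (rule fps_ext)
    fix k show "E 0 $ k = 1 $ k"
    proof (cases k)
      case (Suc m)
      then have "{zs. length zs = k \<and> set zs \<subseteq> letters_below N 0 \<and> successively col_ge zs} = {}"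
        by (auto simp: letters_below_def)
      then show ?thesis using Suc unfolding E_def fps_nth_Abs_fps chain_sum_def by (simp only: sum.empty) simp
    qed (simp add: E_def)
  qed
  then have "E n = descending_prod g n" for n by (induction n) (simp_all add: step)
  moreover have "letters_below N (2 * N + 2) = alphabet N"
    by (auto simp: letters_below_def alphabet_iff)
  ultimately show ?thesis
    using descending_prod_nth_commute[OF g, of "2 * N + 2" k l] by (metis E_def fps_nth_Abs_fps)
qed

unbundle no fps_syntax

section \<open>The quotient by the Kronecker ideal\<close>

lemma list_plus_eq [simp]: "(xs :: 'a list) + ys = xs @ ys"
  by (simp add: plus_list_def)

lemma list_zero_eq [simp]: "(0 :: 'a list) = []"
  by (simp add: zero_list_def)

text \<open>Killing the letters outside the alphabet makes the quotient type independent of \<open>N\<close>: its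
  relations are those that hold modulo every \<^term>\<open>kron_ideal N\<close> after truncation.\<close>

lift_definition trunc :: "nat \<Rightarrow> ncpoly \<Rightarrow> ncpoly" is
  "\<lambda>N f w. f w when set w \<subseteq> alphabet N"
  by (erule finite_subset[rotated]) auto

lemma lookup_trunc:
  "Poly_Mapping.lookup (trunc N f) w = (if set w \<subseteq> alphabet N then Poly_Mapping.lookup f w else 0)"
  by (simp add: trunc.rep_eq when_def)

lemma trunc_plus [simp]: "trunc N (f + g) = trunc N f + trunc N g"
  by (rule poly_mapping_eqI) (simp add: lookup_trunc lookup_add)

lemma trunc_minus [simp]: "trunc N (f - g) = trunc N f - trunc N g"
  by (rule poly_mapping_eqI) (simp add: lookup_trunc lookup_minus)

lemma trunc_uminus [simp]: "trunc N (- f) = - trunc N f"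
  by (rule poly_mapping_eqI) (simp add: lookup_trunc)

lemma trunc_0 [simp]: "trunc N 0 = 0"
  by (rule poly_mapping_eqI) (simp add: lookup_trunc)

lemma trunc_single:
  "trunc N (Poly_Mapping.single w c) = (if set w \<subseteq> alphabet N then Poly_Mapping.single w c else 0)"
  by (rule poly_mapping_eqI) (auto simp: lookup_trunc lookup_single when_def)

lemma ncpoly_one: "(1 :: ncpoly) = Poly_Mapping.single [] 1"
  using single_one[where ?'a = "letter list" and ?'b = int] by simp

lemma trunc_1 [simp]: "trunc N 1 = 1"
  by (simp add: ncpoly_one trunc_single)

lemma trunc_uvar [simp]: "trunc N (uvar x) = (if x \<in> alphabet N then uvar x else 0)"
  by (simp add: uvar_def trunc_single)

lemma poly_mapping_add_induct [case_names single add]: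
  assumes "\<And>k c. P (Poly_Mapping.single k c)" "\<And>f g. P f \<Longrightarrow> P g \<Longrightarrow> P (f + g)"
  shows "P (f :: 'a \<Rightarrow>\<^sub>0 'b::monoid_add)"
proof (induction f rule: Poly_Mapping.update_induct)
  case const
  show ?case using assms(1)[of _ 0] by simp
next
  case (update f k v)
  have "Poly_Mapping.update k v f = f + Poly_Mapping.single k v"
    using update(1) by (auto intro!: poly_mapping_eqI
        simp: Poly_Mapping.lookup_update lookup_add lookup_single when_def in_keys_iff)
  then show ?case using assms update by simp
qed

lemma trunc_mult [simp]: "trunc N (f * g) = trunc N f * trunc N g"
proof (induction f rule: poly_mapping_add_induct)
  case (single k c)
  show ?case
    by (induction g rule: poly_mapping_add_induct)
      (auto simp: mult_single trunc_single when_def distrib_left)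
qed (simp add: distrib_right)

lemma trunc_in_free_alg [simp]: "trunc N f \<in> free_alg N"
  by (auto simp: free_alg_def lookup_trunc in_keys_iff split: if_splits)

lemma lookup_mult_Nil: "Poly_Mapping.lookup (f * g :: ncpoly) [] = Poly_Mapping.lookup f [] * Poly_Mapping.lookup g []"
proof (induction f rule: poly_mapping_add_induct)
  case (single k c)
  show ?case
    by (induction g rule: poly_mapping_add_induct)
      (auto simp: mult_single lookup_single when_def distrib_left lookup_add)
qed (simp add: distrib_right lookup_add)

lemma lookup_uvar_Nil [simp]: "Poly_Mapping.lookup (uvar x) [] = 0"
  by (simp add: uvar_def lookup_single)

text \<open>All relations lack a constant term, so the ideal is proper. This yields the axiom
  \<open>0 \<noteq> 1\<close> that the class \<open>ring_1\<close> demands of the quotient.\<close>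

lemma kron_ideal_lookup_Nil: "f \<in> kron_ideal N \<Longrightarrow> Poly_Mapping.lookup f [] = 0"
proof (induction rule: kron_ideal.induct)
  case (generator g)
  then show ?case
    by (auto simp: kron_generators_def lookup_minus lookup_mult_Nil)
qed (auto simp: lookup_add lookup_mult_Nil)

definition kron_null :: "ncpoly \<Rightarrow> bool" where
  "kron_null f \<longleftrightarrow> (\<forall>N. trunc N f \<in> kron_ideal N)"

lemma kron_null_0: "kron_null 0"
  by (simp add: kron_null_def kron_ideal.zero)

lemma kron_null_add: "kron_null f \<Longrightarrow> kron_null g \<Longrightarrow> kron_null (f + g)"
  by (simp add: kron_null_def kron_ideal.add)

lemma kron_null_uminus: "kron_null f \<Longrightarrow> kron_null (- f)"
  by (simp add: kron_null_def kron_ideal.uminus)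

lemma kron_null_mult: "kron_null f \<Longrightarrow> kron_null (p * f)" "kron_null f \<Longrightarrow> kron_null (f * p)"
  by (simp_all add: kron_null_def kron_ideal.mult_left kron_ideal.mult_right)

lemma kron_null_1: "\<not> kron_null 1"
proof
  assume "kron_null 1"
  then have "(1 :: ncpoly) \<in> kron_ideal 0" unfolding kron_null_def by (metis trunc_1)
  then have "Poly_Mapping.lookup (1 :: ncpoly) [] = 0" by (rule kron_ideal_lookup_Nil)
  then show False by (simp add: ncpoly_one)
qed

lemma kron_null_trans:
  assumes "kron_null f" "kron_null g" "f + g = h" shows "kron_null h"
  using kron_null_add[OF assms(1,2)] assms(3) by simp

lemma kron_null_minus_swap: "kron_null (f - g) \<Longrightarrow> kron_null (g - f)"
  using kron_null_uminus[of "f - g"] by simp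

quotient_type kron_quot = ncpoly / "\<lambda>f g. kron_null (f - g)"
proof (rule equivpI)
  show "reflp (\<lambda>f g. kron_null (f - g))" by (simp add: reflp_def kron_null_0)
  show "symp (\<lambda>f g. kron_null (f - g))" by (rule sympI) (rule kron_null_minus_swap)
  show "transp (\<lambda>f g. kron_null (f - g))"
    by (rule transpI) (erule (1) kron_null_trans, simp)
qed

instantiation kron_quot :: ring_1
begin

lift_definition zero_kron_quot :: kron_quot is "0 :: ncpoly" .

lift_definition one_kron_quot :: kron_quot is "1 :: ncpoly" .

lift_definition plus_kron_quot :: "kron_quot \<Rightarrow> kron_quot \<Rightarrow> kron_quot" is "(+) :: ncpoly \<Rightarrow> _"
proof -
  fix a b c d :: ncpoly
  assume "kron_null (a - b)" "kron_null (c - d)"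
  then show "kron_null (a + c - (b + d))"
    by (rule kron_null_trans) (rule add_diff_add[symmetric])
qed

lift_definition uminus_kron_quot :: "kron_quot \<Rightarrow> kron_quot" is "uminus :: ncpoly \<Rightarrow> _"
proof -
  fix a b :: ncpoly
  assume "kron_null (a - b)"
  then show "kron_null (- a - - b)"
    by (subst minus_diff_minus) (rule kron_null_uminus)
qed

lift_definition minus_kron_quot :: "kron_quot \<Rightarrow> kron_quot \<Rightarrow> kron_quot" is "(-) :: ncpoly \<Rightarrow> _"
proof -
  fix a b c d :: ncpoly
  assume "kron_null (a - b)" "kron_null (c - d)"
  then show "kron_null (a - c - (b - d))"
    by (rule kron_null_trans[OF _ kron_null_minus_swap]) (simp only: diff_diff_eq2 add_diff_eq diff_add_eq diff_diff_add add_ac)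
qed

lift_definition times_kron_quot :: "kron_quot \<Rightarrow> kron_quot \<Rightarrow> kron_quot" is "(*) :: ncpoly \<Rightarrow> _"
proof -
  fix a b c d :: ncpoly
  assume "kron_null (a - b)" "kron_null (c - d)"
  then show "kron_null (a * c - b * d)"
    by (rule kron_null_trans[OF kron_null_mult(2)[of _ c] kron_null_mult(1)[of _ b]])
      (simp only: left_diff_distrib right_diff_distrib diff_add_cancel diff_add_eq_diff_diff_swap add_diff_eq)
qed

lemmas kron_quot_abs_eq = zero_kron_quot.abs_eq one_kron_quot.abs_eq plus_kron_quot.abs_eq
  uminus_kron_quot.abs_eq minus_kron_quot.abs_eq times_kron_quot.abs_eq

instance
proof
  fix a b c :: kron_quot
  obtain f g h where "a = abs_kron_quot f" "b = abs_kron_quot g" "c = abs_kron_quot h"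
    by (induction a rule: kron_quot.abs_induct; induction b rule: kron_quot.abs_induct;
        induction c rule: kron_quot.abs_induct; blast)
  note * = this kron_quot_abs_eq
  show "a + b + c = a + (b + c)" "a + b = b + a" "0 + a = a" "- a + a = 0" "a - b = a + - b"
    "a * b * c = a * (b * c)" "1 * a = a" "a * 1 = a"
    "(a + b) * c = a * c + b * c" "a * (b + c) = a * b + a * c"
    unfolding * by (simp_all only: algebra_simps ab_left_minus mult_1_left mult_1_right add_0_left right_minus
      diff_conv_add_uminus)
  show "0 \<noteq> (1 :: kron_quot)"
    unfolding * kron_quot.abs_eq_iff using kron_null_1 kron_null_minus_swap[of 0 1] by (metis diff_0_right)
qed

end

lemma abs_kron_quot_cases: obtains f where "x = abs_kron_quot f"
  by (induction x rule: kron_quot.abs_induct) blast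

lemma abs_kron_quot_hom:
  "abs_kron_quot 0 = 0" "abs_kron_quot 1 = 1"
  "abs_kron_quot (f + g) = abs_kron_quot f + abs_kron_quot g"
  "abs_kron_quot (f - g) = abs_kron_quot f - abs_kron_quot g"
  "abs_kron_quot (- f) = - abs_kron_quot f"
  "abs_kron_quot (f * g) = abs_kron_quot f * abs_kron_quot g"
  by (simp_all only: kron_quot_abs_eq)

lemma abs_kron_quot_eq_0_iff: "abs_kron_quot f = 0 \<longleftrightarrow> kron_null f"
  by (simp only: zero_kron_quot.abs_eq kron_quot.abs_eq_iff diff_0_right)

lemma kron_generators_cases [consumes 1, case_names 1 2 3 4 5 6]:
  assumes "g \<in> kron_generators N"
  obtains
    x y where "g = uvar y * uvar y * uvar x - uvar y * uvar x * uvar y"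
      "x \<in> alphabet N" "y \<in> alphabet N" "\<not> barred y" "x < y"
  | z y where "g = uvar z * uvar y * uvar y - uvar y * uvar z * uvar y"
      "z \<in> alphabet N" "y \<in> alphabet N" "\<not> barred y" "y < z"
  | z y where "g = uvar y * uvar y * uvar z - uvar y * uvar z * uvar y"
      "z \<in> alphabet N" "y \<in> alphabet N" "barred y" "y < z"
  | x y where "g = uvar x * uvar y * uvar y - uvar y * uvar x * uvar y"
      "x \<in> alphabet N" "y \<in> alphabet N" "barred y" "x < y"
  | x y z where "g = (uvar x * uvar z - uvar z * uvar x) * uvar y - uvar y * (uvar x * uvar z - uvar z * uvar x)"
      "x \<in> alphabet N" "y \<in> alphabet N" "z \<in> alphabet N" "down y = Some x" "down2 z = Some x"
  | x z v where "g = uvar x * uvar z - uvar z * uvar x"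
      "x \<in> alphabet N" "z \<in> alphabet N" "down2 z = Some v" "x < v"
  using assms unfolding kron_generators_def
  by (elim UnE CollectE exE conjE) (erule (4) that | erule (3) that | erule (5) that)+

lemma kron_generators_intro1:
  "x \<in> alphabet N \<Longrightarrow> y \<in> alphabet N \<Longrightarrow> \<not> barred y \<Longrightarrow> x < y \<Longrightarrow>
     uvar y * uvar y * uvar x - uvar y * uvar x * uvar y \<in> kron_generators N"
  unfolding kron_generators_def
  by (rule UnI1, rule UnI1, rule UnI1, rule UnI1, rule UnI1, rule CollectI, intro exI conjI, (rule refl | assumption)+)

lemma kron_generators_intro2:
  "z \<in> alphabet N \<Longrightarrow> y \<in> alphabet N \<Longrightarrow> \<not> barred y \<Longrightarrow> y < z \<Longrightarrow>
     uvar z * uvar y * uvar y - uvar y * uvar z * uvar y \<in> kron_generators N"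
  unfolding kron_generators_def
  by (rule UnI1, rule UnI1, rule UnI1, rule UnI1, rule UnI2, rule CollectI, intro exI conjI, (rule refl | assumption)+)

lemma kron_generators_intro3:
  "z \<in> alphabet N \<Longrightarrow> y \<in> alphabet N \<Longrightarrow> barred y \<Longrightarrow> y < z \<Longrightarrow>
     uvar y * uvar y * uvar z - uvar y * uvar z * uvar y \<in> kron_generators N"
  unfolding kron_generators_def
  by (rule UnI1, rule UnI1, rule UnI1, rule UnI2, rule CollectI, intro exI conjI, (rule refl | assumption)+)

lemma kron_generators_intro4:
  "x \<in> alphabet N \<Longrightarrow> y \<in> alphabet N \<Longrightarrow> barred y \<Longrightarrow> x < y \<Longrightarrow>
     uvar x * uvar y * uvar y - uvar y * uvar x * uvar y \<in> kron_generators N"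
  unfolding kron_generators_def
  by (rule UnI1, rule UnI1, rule UnI2, rule CollectI, intro exI conjI, (rule refl | assumption)+)

lemma kron_generators_intro5:
  "x \<in> alphabet N \<Longrightarrow> y \<in> alphabet N \<Longrightarrow> z \<in> alphabet N \<Longrightarrow> down y = Some x \<Longrightarrow> down2 z = Some x \<Longrightarrow>
     (uvar x * uvar z - uvar z * uvar x) * uvar y - uvar y * (uvar x * uvar z - uvar z * uvar x)
       \<in> kron_generators N"
  unfolding kron_generators_def
  by (rule UnI1, rule UnI2, rule CollectI, intro exI conjI, (rule refl | assumption)+)

lemma kron_generators_intro6:
  "x \<in> alphabet N \<Longrightarrow> z \<in> alphabet N \<Longrightarrow> down2 z = Some v \<Longrightarrow> x < v \<Longrightarrow>
     uvar x * uvar z - uvar z * uvar x \<in> kron_generators N"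
  unfolding kron_generators_def
  by (rule UnI2, rule CollectI, intro exI conjI, (rule refl | assumption)+)

lemmas kron_generators_intros =
  kron_generators_intro1 kron_generators_intro2 kron_generators_intro3
  kron_generators_intro4 kron_generators_intro5 kron_generators_intro6

text \<open>All monomials of a generator contain the same letters, so truncation either keeps the
  generator whole or kills it.\<close>

lemma trunc_kron_generator:
  assumes "g \<in> kron_generators N"
  shows "trunc M g = 0 \<or> trunc M g \<in> kron_generators M"
  using assms
proof (cases rule: kron_generators_cases)
  case (1 x y)
  then show ?thesis
    using kron_generators_intros(1)[of x M y] by (cases "x \<in> alphabet M \<and> y \<in> alphabet M") auto
next
  case (2 z y)
  then show ?thesis
    using kron_generators_intros(2)[of z M y] by (cases "z \<in> alphabet M \<and> y \<in> alphabet M") auto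
next
  case (3 z y)
  then show ?thesis
    using kron_generators_intros(3)[of z M y] by (cases "z \<in> alphabet M \<and> y \<in> alphabet M") auto
next
  case (4 x y)
  then show ?thesis
    using kron_generators_intros(4)[of x M y] by (cases "x \<in> alphabet M \<and> y \<in> alphabet M") auto
next
  case (5 x y z)
  then show ?thesis
    using kron_generators_intros(5)[of x M y z]
    by (cases "x \<in> alphabet M \<and> y \<in> alphabet M \<and> z \<in> alphabet M") auto
next
  case (6 x z v)
  then show ?thesis
    using kron_generators_intros(6)[of x M z v] by (cases "x \<in> alphabet M \<and> z \<in> alphabet M") auto
qed

lemma abs_kron_quot_generator: "g \<in> kron_generators N \<Longrightarrow> abs_kron_quot g = 0"
  unfolding abs_kron_quot_eq_0_iff kron_null_def
  using trunc_kron_generator kron_ideal.zero kron_ideal.generator by metis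

section \<open>The pairing as a functional on the quotient\<close>

lemma pairing_eq_sum:
  assumes "finite A" "Poly_Mapping.keys f \<subseteq> A"
  shows "pairing f g = (\<Sum>w\<in>A. Poly_Mapping.lookup f w * Poly_Mapping.lookup g w)"
  unfolding pairing_def using assms by (intro sum.mono_neutral_left) (auto simp: in_keys_iff)

lemma pairing_add: "pairing (f + f') g = pairing f g + pairing f' g"
proof -
  let ?A = "Poly_Mapping.keys f \<union> Poly_Mapping.keys f'"
  have "Poly_Mapping.keys (f + f') \<subseteq> ?A" by (rule keys_add)
  then show ?thesis
    by (simp add: pairing_eq_sum[of ?A] lookup_add distrib_right sum.distrib)
qed

lemma pairing_0 [simp]: "pairing 0 g = 0"
  by (simp add: pairing_def)

lemma pairing_uminus: "pairing (- f) g = - pairing f g"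
  using pairing_add[of f "- f" g] by simp

lemma pairing_diff: "pairing (f - f') g = pairing f g - pairing f' g"
  using pairing_add[of f "- f'" g] by (simp add: pairing_uminus)

lemma pairing_sum: "pairing (\<Sum>i\<in>I. f i) g = (\<Sum>i\<in>I. pairing (f i) g)"
  by (induction I rule: infinite_finite_induct) (simp_all add: pairing_add)

lemma pairing_single: "pairing (Poly_Mapping.single w 1) g = Poly_Mapping.lookup g w"
  by (simp add: pairing_def)

lemma pairing_of_nat_mult: "pairing (of_nat n * f) g = of_nat n * pairing f g"
  by (induction n) (simp_all add: pairing_add distrib_right)

lemma pairing_of_int_mult: "pairing (of_int c * f) g = c * pairing f g"
  by (cases c rule: int_cases2) (simp_all add: pairing_of_nat_mult pairing_uminus)

lemma pairing_trunc:
  assumes "g \<in> free_alg N" shows "pairing (trunc N f) g = pairing f g"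
proof -
  have "Poly_Mapping.keys (trunc N f) \<subseteq> Poly_Mapping.keys f"
    by (auto simp: lookup_trunc in_keys_iff split: if_splits)
  then have "pairing (trunc N f) g = (\<Sum>w\<in>Poly_Mapping.keys f. Poly_Mapping.lookup (trunc N f) w * Poly_Mapping.lookup g w)"
    by (intro pairing_eq_sum) auto
  also have "\<dots> = pairing f g"
    unfolding pairing_def using assms
    by (intro sum.cong) (auto simp: lookup_trunc free_alg_def in_keys_iff)
  finally show ?thesis .
qed

text \<open>Equality of classes is a condition on all alphabets. The one for \<open>N\<close> is
  extracted by truncation, and \<open>g\<close> does not see the words that truncation
  removes.\<close>

lemma pairing_cong_kron:
  assumes "g \<in> kron_perp N" "abs_kron_quot f = abs_kron_quot f'"
  shows "pairing f g = pairing f' g"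
proof -
  have "kron_null (f - f')"
    using assms(2) by (simp add: kron_quot.abs_eq_iff)
  then have "pairing (trunc N (f - f')) g = 0"
    using assms(1) unfolding kron_null_def kron_perp_def by blast
  then show ?thesis using assms(1) by (simp only: pairing_trunc kron_perp_def mem_Collect_eq pairing_diff)
qed

text \<open>Position 2 is the unbarred letter 1, on which \<open>down\<close> is undefined; hence
  the bound 3 here and 4 for \<open>down2\<close>.\<close>

lemma down_letter_at: "3 \<le> n \<Longrightarrow> down (letter_at n) = Some (letter_at (n - 1))"
  by (cases "even n") (auto simp: letter_at_def elim!: evenE oddE)

lemma down2_letter_at: "4 \<le> n \<Longrightarrow> down2 (letter_at n) = Some (letter_at (n - 2))"
  by (simp add: down2_def down_letter_at numeral_2_eq_2)

lemma kron_letters_quot: "kron_letters (letter_value N (\<lambda>x. abs_kron_quot (uvar x)))"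
proof -
  let ?q = "\<lambda>n. abs_kron_quot (uvar (letter_at n))"
  let ?u = "letter_value N (\<lambda>x. abs_kron_quot (uvar x))"
  have u: "?u n = (if letter_at n \<in> alphabet N then ?q n else 0)" for n
    by (simp add: letter_value_def)
  have less: "letter_at i < letter_at j" if "i < j" for i j
    using that by (simp add: less_letter_def)
  note gen = kron_generators_intros[of _ N, THEN abs_kron_quot_generator]
  note hom = abs_kron_quot_hom(4,6)
  show ?thesis
  proof (unfold_locales, goal_cases)
    case (1 j i)
    have "?q j * ?q j * ?q i - ?q j * ?q i * ?q j = 0"
      if "letter_at i \<in> alphabet N" "letter_at j \<in> alphabet N"
      unfolding hom[symmetric] using 1 that less by (intro gen(1)) simp_all
    then show ?case by (simp add: u algebra_simps)
  next
    case (2 i j)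
    have "?q j * ?q i * ?q i - ?q i * ?q j * ?q i = 0"
      if "letter_at i \<in> alphabet N" "letter_at j \<in> alphabet N"
      unfolding hom[symmetric] using 2 that less by (intro gen(2)) simp_all
    then show ?case by (simp add: u algebra_simps)
  next
    case (3 i j)
    have "?q i * ?q i * ?q j - ?q i * ?q j * ?q i = 0"
      if "letter_at i \<in> alphabet N" "letter_at j \<in> alphabet N"
      unfolding hom[symmetric] using 3 that less by (intro gen(3)) simp_all
    then show ?case by (simp add: u algebra_simps)
  next
    case (4 j i)
    have "?q i * ?q j * ?q j - ?q j * ?q i * ?q j = 0"
      if "letter_at i \<in> alphabet N" "letter_at j \<in> alphabet N"
      unfolding hom[symmetric] using 4 that less by (intro gen(4)) simp_all
    then show ?case by (simp add: u algebra_simps)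
  next
    case (5 i)
    have "(?q i * ?q (i + 2) - ?q (i + 2) * ?q i) * ?q (i + 1) -
        ?q (i + 1) * (?q i * ?q (i + 2) - ?q (i + 2) * ?q i) = 0"
      if "letter_at i \<in> alphabet N" "letter_at (i + 1) \<in> alphabet N" "letter_at (i + 2) \<in> alphabet N"
    proof -
      have "2 \<le> i" using that by (simp add: alphabet_iff)
      then have "down (letter_at (i + 1)) = Some (letter_at i)" "down2 (letter_at (i + 2)) = Some (letter_at i)"
        by (simp_all add: down_letter_at down2_letter_at)
      then show ?thesis unfolding hom[symmetric] using that by (intro gen(5))
    qed
    then show ?case by (simp add: u)
  next
    case (6 i j)
    have "?q i * ?q j - ?q j * ?q i = 0"
      if "letter_at i \<in> alphabet N" "letter_at j \<in> alphabet N"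
    proof -
      have "2 \<le> i" using that by (simp add: alphabet_iff)
      then have "down2 (letter_at j) = Some (letter_at (j - 2))" "letter_at i < letter_at (j - 2)"
        using 6 less by (simp_all add: down2_letter_at)
      then show ?thesis unfolding hom[symmetric] using that by (intro gen(6))
    qed
    then show ?case by (simp add: u)
  qed
qed

lemma abs_kron_quot_of_nat: "abs_kron_quot (of_nat n) = of_nat n"
  by (induction n) (simp_all add: abs_kron_quot_hom)

lemma abs_kron_quot_of_int: "abs_kron_quot (of_int c) = of_int c"
  by (cases c rule: int_cases2) (simp_all add: abs_kron_quot_hom abs_kron_quot_of_nat)

lemma abs_kron_quot_sum: "abs_kron_quot (\<Sum>i\<in>I. f i) = (\<Sum>i\<in>I. abs_kron_quot (f i))"
  by (induction I rule: infinite_finite_induct) (simp_all add: abs_kron_quot_hom)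

lemma abs_kron_quot_prod_list: "abs_kron_quot (prod_list xs) = prod_list (map abs_kron_quot xs)"
  by (induction xs) (simp_all add: abs_kron_quot_hom)

lemma abs_kron_quot_chain_sum:
  "abs_kron_quot (chain_sum R A v k) = chain_sum R A (\<lambda>x. abs_kron_quot (v x)) k"
  unfolding chain_sum_def abs_kron_quot_sum abs_kron_quot_prod_list by (simp add: comp_def)

lemma nc_elem_eq: "nc_elem N k = (if k < 0 then 0 else chain_sum col_ge (alphabet N) uvar (nat k))"
  by (simp add: nc_elem_def chain_sum_def)

lemma nc_elem_commute:
  "abs_kron_quot (nc_elem N k) * abs_kron_quot (nc_elem N l) =
   abs_kron_quot (nc_elem N l) * abs_kron_quot (nc_elem N k)"
  using chain_sums_commute[OF kron_letters_quot, of N]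
  by (auto simp: nc_elem_eq abs_kron_quot_hom abs_kron_quot_chain_sum)

section \<open>Complete sums and evaluation at a commuting sequence\<close>

lemma chain_sum_mult:
  fixes v :: "'b \<Rightarrow> 'a::ring_1"
  assumes "finite A"
  shows "chain_sum R A v i * chain_sum S A v j =
    (\<Sum>w | length w = i + j \<and> set w \<subseteq> A \<and> successively R (take i w) \<and> successively S (drop i w).
       prod_list (map v w))"
proof -
  let ?X = "{zs. length zs = i \<and> set zs \<subseteq> A \<and> successively R zs}"
  let ?Y = "{zs. length zs = j \<and> set zs \<subseteq> A \<and> successively S zs}"
  have "chain_sum R A v i * chain_sum S A v j = (\<Sum>(xs, ys)\<in>?X \<times> ?Y. prod_list (map v (xs @ ys)))"
    by (simp add: chain_sum_def sum_product sum.cartesian_product)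
  also have "\<dots> = (\<Sum>w | length w = i + j \<and> set w \<subseteq> A \<and> successively R (take i w) \<and> successively S (drop i w).
       prod_list (map v w))"
    by (rule sum.reindex_bij_witness[of _ "\<lambda>w. (take i w, drop i w)" "\<lambda>(xs, ys). xs @ ys"])
      (auto dest: in_set_takeD in_set_dropD)
  finally show ?thesis .
qed

lemma successively_take_Suc:
  assumes "0 < i" "i < length w"
  shows "successively R (take (Suc i) w) \<longleftrightarrow> successively R (take i w) \<and> R (w ! (i - 1)) (w ! i)"
proof -
  have ne: "take i w \<noteq> []" using assms by auto
  then have "last (take i w) = w ! (i - 1)" using assms(2) by (simp add: last_conv_nth)
  with ne show ?thesis using assms(2) by (simp add: take_Suc_conv_app_nth successively_append_iff)
qed

lemma successively_drop_pred:
  assumes "0 < i" "i < length w"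
  shows "successively R (drop (i - 1) w) \<longleftrightarrow> successively R (drop i w) \<and> R (w ! (i - 1)) (w ! i)"
proof -
  have "hd (drop i w) = w ! i" "drop i w \<noteq> []" using assms by (simp_all add: hd_drop_conv_nth)
  moreover have "drop (i - 1) w = w ! (i - 1) # drop i w"
    using Cons_nth_drop_Suc[of "i - 1" w] assms by simp
  ultimately show ?thesis by (auto simp: successively_Cons)
qed

text \<open>Every product of a chain of length \<open>i\<close> with an antichain of length \<open>k - i\<close> splits into two
  hook sums, according to which of the two the junction extends; the alternating sum telescopes.\<close>

lemma chain_sum_alternating:
  fixes v :: "'b \<Rightarrow> 'a::ring_1"
  assumes "finite A" "0 < k"
  shows "(\<Sum>i\<le>k. (- 1) ^ i * (chain_sum R A v i * chain_sum (\<lambda>x y. \<not> R x y) A v (k - i))) = 0"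
proof -
  define W where "W i = {w. length w = k \<and> set w \<subseteq> A \<and>
    successively R (take i w) \<and> successively (\<lambda>x y. \<not> R x y) (drop (i - 1) w)}" for i
  define X where "X i = (if 0 < i \<and> i \<le> k then \<Sum>w\<in>W i. prod_list (map v w) else 0)" for i
  have fin: "finite (W i)" for i
    unfolding W_def by (rule finite_words[OF assms(1)])
  have split: "chain_sum R A v i * chain_sum (\<lambda>x y. \<not> R x y) A v (k - i) = X i + X (Suc i)" if ik: "i \<le> k" for i
  proof -
    let ?V = "{w. length w = k \<and> set w \<subseteq> A \<and> successively R (take i w) \<and> successively (\<lambda>x y. \<not> R x y) (drop i w)}"
    have eq: "chain_sum R A v i * chain_sum (\<lambda>x y. \<not> R x y) A v (k - i) = (\<Sum>w\<in>?V. prod_list (map v w))"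
      using chain_sum_mult[OF assms(1), of R v i _ "k - i"] ik by simp
    consider "i = 0" | "i = k" | "0 < i" "i < k" using ik by linarith
    then show ?thesis
    proof cases
      case 1
      have "successively R (take 1 w)" for w by (cases w) auto
      then have "?V = W 1" using 1 by (auto simp: W_def)
      then show ?thesis unfolding eq using 1 assms(2) by (simp add: X_def)
    next
      case 2
      have "successively (\<lambda>x y. \<not> R x y) (drop (k - 1) w)" if "length w = k" for w
        using that assms(2) by (cases w rule: rev_cases) auto
      then have "?V = W k" using 2 by (auto simp: W_def)
      then show ?thesis unfolding eq using 2 assms(2) by (simp add: X_def)
    next
      case 3
      have "?V = W i \<union> W (Suc i)" "W i \<inter> W (Suc i) = {}"
        using 3 by (auto simp: W_def successively_take_Suc successively_drop_pred[OF 3(1), unfolded One_nat_def])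
      then show ?thesis unfolding eq using 3 fin by (simp add: X_def sum.union_disjoint)
    qed
  qed
  have "(\<Sum>i\<le>n. (- 1) ^ i * (X i + X (Suc i))) = X 0 + (- 1) ^ n * X (Suc n)" for n
    by (induction n) (simp_all add: distrib_left)
  from this[of k] show ?thesis by (simp add: split) (simp add: X_def)
qed

section \<open>Evaluation of commutative polynomials in a noncommutative ring\<close>

locale commuting_sequence =
  fixes e :: "nat \<Rightarrow> 'a::ring_1"
  assumes commute: "e i * e j = e j * e i"
begin

definition monom_upto :: "nat \<Rightarrow> (nat \<Rightarrow>\<^sub>0 nat) \<Rightarrow> 'a" where
  "monom_upto n m = prod_list (map (\<lambda>k. e k ^ Poly_Mapping.lookup m k) [0..<n])"

text \<open>\<open>Poly_Mapping.degree m\<close> is a strict upper bound for the indices occurring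
  in \<open>m\<close>, not the degree of the monomial, so no factor is cut off.\<close>

definition eval_monom :: "(nat \<Rightarrow>\<^sub>0 nat) \<Rightarrow> 'a" where
  "eval_monom m = monom_upto (Poly_Mapping.degree m) m"

definition eval_poly :: "((nat \<Rightarrow>\<^sub>0 nat) \<Rightarrow>\<^sub>0 int) \<Rightarrow> 'a" where
  "eval_poly f = (\<Sum>m\<in>Poly_Mapping.keys f. of_int (Poly_Mapping.lookup f m) * eval_monom m)"

lemma power_commute: "e i ^ a * e j ^ b = e j ^ b * e i ^ a"
  by (metis commute power_commuting_commutes)

lemma monom_upto_commute: "e i ^ a * monom_upto n m = monom_upto n m * e i ^ a"
proof (induction n)
  case (Suc n)
  have "e i ^ a * (monom_upto n m * e n ^ b) = monom_upto n m * e n ^ b * e i ^ a" for b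
    by (metis Suc power_commute mult.assoc)
  then show ?case by (simp add: monom_upto_def)
qed (simp add: monom_upto_def)

lemma monom_upto_add: "monom_upto n (m + m') = monom_upto n m * monom_upto n m'"
proof (induction n)
  case (Suc n)
  have "monom_upto n m * monom_upto n m' * (e n ^ a * e n ^ b) =
      monom_upto n m * e n ^ a * (monom_upto n m' * e n ^ b)" for a b
    by (metis monom_upto_commute mult.assoc)
  with Suc show ?case by (simp add: monom_upto_def lookup_add power_add)
qed (simp add: monom_upto_def)

lemma monom_upto_eq: "Poly_Mapping.degree m \<le> n \<Longrightarrow> monom_upto n m = eval_monom m"
proof (induction n)
  case (Suc n)
  then show ?case
    by (cases "Poly_Mapping.degree m = Suc n")
      (simp_all add: eval_monom_def monom_upto_def beyond_degree_lookup_zero)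
qed (simp add: eval_monom_def monom_upto_def)

lemma eval_monom_add: "eval_monom (m + m') = eval_monom m * eval_monom m'"
proof -
  let ?n = "max (Poly_Mapping.degree m) (Poly_Mapping.degree m')"
  have "eval_monom (m + m') = monom_upto ?n (m + m')"
    by (simp add: monom_upto_eq degree_add)
  also have "\<dots> = eval_monom m * eval_monom m'"
    by (simp add: monom_upto_add monom_upto_eq)
  finally show ?thesis .
qed

lemma eval_poly_add: "eval_poly (f + g) = eval_poly f + eval_poly g"
  unfolding eval_poly_def by (rule setsum_keys_plus_distrib) (simp_all add: distrib_right)

lemma eval_poly_single: "eval_poly (Poly_Mapping.single m c) = of_int c * eval_monom m"
  by (simp add: eval_poly_def)

lemma eval_poly_mult: "eval_poly (f * g) = eval_poly f * eval_poly g"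
proof (induction f rule: poly_mapping_add_induct)
  case (single m c)
  show ?case
  proof (induction g rule: poly_mapping_add_induct)
    case (single m' c')
    have "of_int (c * c') * (eval_monom m * eval_monom m') =
        of_int c * eval_monom m * (of_int c' * eval_monom m')"
      by (metis mult.assoc mult_of_int_commute of_int_mult)
    then show ?case by (simp add: mult_single eval_poly_single eval_monom_add)
  qed (simp add: distrib_left eval_poly_add)
qed (simp add: distrib_right eval_poly_add)

lemma eval_poly_0 [simp]: "eval_poly 0 = 0"
  by (simp add: eval_poly_def)

lemma eval_poly_1 [simp]: "eval_poly 1 = 1"
  by (simp add: eval_poly_def eval_monom_def monom_upto_def)

lemma eval_poly_uminus: "eval_poly (- f) = - eval_poly f"
  using eval_poly_add[of f "- f"] by (simp add: eq_neg_iff_add_eq_0 add.commute)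

lemma eval_poly_of_int [simp]: "eval_poly (of_int c) = of_int c"
  by (subst single_of_int[symmetric], subst eval_poly_single) (simp add: eval_monom_def monom_upto_def)

lemma eval_poly_sum: "eval_poly (\<Sum>i\<in>I. f i) = (\<Sum>i\<in>I. eval_poly (f i))"
  by (induction I rule: infinite_finite_induct) (simp_all add: eval_poly_add)

lemma eval_poly_prod_list: "eval_poly (prod_list fs) = prod_list (map eval_poly fs)"
  by (induction fs) (simp_all add: eval_poly_mult)

lemma eval_poly_power: "eval_poly (f ^ n) = eval_poly f ^ n"
  by (induction n) (simp_all add: eval_poly_mult)

lemma eval_poly_var: "eval_poly (Poly_Mapping.single (Poly_Mapping.single k 1) 1) = e k"
proof -
  have "monom_upto n (Poly_Mapping.single k 1) = (if k < n then e k else 1)" for n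
    by (induction n) (auto simp: monom_upto_def lookup_single when_def less_Suc_eq)
  then show ?thesis by (simp add: eval_poly_single eval_monom_def)
qed

end

section \<open>Jacobi--Trudi determinants\<close>

lemma sum_det_shift_rows:
  fixes f :: "nat \<Rightarrow> nat \<Rightarrow> 'r::comm_ring_1"
  shows "(\<Sum>S | S \<subseteq> {..<n} \<and> card S = k. det (mat n n (\<lambda>(i, j). f i (j + of_bool (i \<in> S))))) =
         (\<Sum>S | S \<subseteq> {..<n} \<and> card S = k. det (mat n n (\<lambda>(i, j). f i (j + of_bool (j \<in> S)))))"
proof -
  let ?Ss = "{S. S \<subseteq> {..<n} \<and> card S = k}"
  let ?P = "{p. p permutes {0..<n}}"
  have det: "det (mat n n g) = (\<Sum>p\<in>?P. of_int (sign p) * (\<Prod>i=0..<n. g (i, p i)))"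
    for g :: "nat \<times> nat \<Rightarrow> 'r"
  proof -
    have "p permutes {0..<n} \<Longrightarrow> i < n \<Longrightarrow> p i < n" for p i
      using permutes_in_image[of p "{0..<n}" i] by simp
    then show ?thesis
      unfolding det_def'[OF mat_carrier] by (intro sum.cong arg_cong2[of _ _ _ _ "(*)"] prod.cong refl) auto
  qed
  have shift: "(\<Sum>S\<in>?Ss. \<Prod>i=0..<n. f i (p i + of_bool (i \<in> S))) =
      (\<Sum>S\<in>?Ss. \<Prod>i=0..<n. f i (p i + of_bool (p i \<in> S)))" if p: "p permutes {0..<n}" for p
  proof (rule sum.reindex_bij_witness[of _ "\<lambda>S. p -` S" "\<lambda>S. p ` S"])
    have inj: "inj p" and surj: "surj p" using permutes_inj[OF p] permutes_surj[OF p] by auto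
    have pn: "p i < n \<longleftrightarrow> i < n" for i using permutes_in_image[OF p, of i] by simp
    fix S assume S: "S \<in> ?Ss"
    show "p -` p ` S = S" using inj by (rule inj_vimage_image_eq)
    show "p ` p -` S = S" using surj by (rule surj_image_vimage_eq)
    show "p ` S \<in> ?Ss" using S inj pn by (auto simp: card_image inj_on_subset)
    show "p -` S \<in> ?Ss" using S inj surj pn by (auto simp: card_vimage_inj)
    show "(\<Prod>i=0..<n. f i (p i + of_bool (p i \<in> p ` S))) = (\<Prod>i=0..<n. f i (p i + of_bool (i \<in> S)))"
      by (simp add: inj_image_mem_iff[OF inj])
  qed
  have swap: "(\<Sum>S\<in>?Ss. \<Sum>p\<in>?P. of_int (sign p) * G p S) = (\<Sum>p\<in>?P. of_int (sign p) * (\<Sum>S\<in>?Ss. G p S))"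
    for G :: "_ \<Rightarrow> _ \<Rightarrow> 'r"
    by (subst sum.swap) (simp add: sum_distrib_left)
  show ?thesis
    unfolding det prod.case swap by (rule sum.cong[OF refl]) (simp only: shift mem_Collect_eq)
qed

text \<open>The shifted column \<open>j\<close> coincides with the unshifted column
  \<open>Suc j\<close>.\<close>

lemma det_shift_columns_eq_0:
  fixes f :: "nat \<Rightarrow> nat \<Rightarrow> 'r::comm_ring_1"
  assumes "j \<in> S" "Suc j \<notin> S" "Suc j < n"
  shows "det (mat n n (\<lambda>(i, j). f i (j + of_bool (j \<in> S)))) = 0"
  by (rule det_identical_columns[OF mat_carrier, of j "Suc j"])
    (use assms in \<open>auto intro!: eq_vecI\<close>)

lemma upclosed_interval:
  assumes "S \<subseteq> {..<n}" "card S = k" "\<And>j. j \<in> S \<Longrightarrow> Suc j < n \<Longrightarrow> Suc j \<in> S"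
  shows "S = {n - k..<n}"
proof -
  have fin: "finite S" using assms(1) finite_subset by blast
  have up: "j + d \<in> S" if "j \<in> S" "j + d < n" for j d
    using that(2) by (induction d) (use that(1) assms(3) in auto)
  have "S = {n - card S..<n}"
  proof (cases "S = {}")
    case False
    define m where "m = Min S"
    have m: "m \<in> S" "\<And>j. j \<in> S \<Longrightarrow> m \<le> j" using False fin by (auto simp: m_def)
    have "S = {m..<n}"
    proof
      show "S \<subseteq> {m..<n}" using m assms(1) by auto
      show "{m..<n} \<subseteq> S" using up[OF m(1)] by (metis atLeastLessThan_iff le_add_diff_inverse subsetI)
    qed
    moreover from this have "card S = n - m" by simp
    moreover have "m < n" using m(1) assms(1) by auto
    ultimately show ?thesis by simp
  qed simp
  then show ?thesis using assms(2) by simp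
qed

text \<open>In a nonzero term \<open>S\<close> contains the successor of each of its elements that
  is below \<open>n\<close>, so it consists of the last \<open>k\<close> columns. What remains is
  the array with \<open>n + 1\<close> columns from which column \<open>n - k\<close> is left
  out.\<close>

lemma sum_det_shift_columns:
  fixes f :: "nat \<Rightarrow> nat \<Rightarrow> 'r::comm_ring_1"
  assumes "k \<le> n"
  shows "(\<Sum>S | S \<subseteq> {..<n} \<and> card S = k. det (mat n n (\<lambda>(i, j). f i (j + of_bool (j \<in> S))))) =
    det (mat n n (\<lambda>(i, j). f i (if j < n - k then j else Suc j)))"
proof -
  let ?Ss = "{S. S \<subseteq> {..<n} \<and> card S = k}"
  let ?T = "{n - k..<n}"
  have T: "?T \<in> ?Ss" using assms by auto
  have "det (mat n n (\<lambda>(i, j). f i (j + of_bool (j \<in> S)))) = 0" if "S \<in> ?Ss - {?T}" for S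
    using that upclosed_interval[of S n k] det_shift_columns_eq_0[of _ S n f] by blast
  then have "(\<Sum>S\<in>?Ss. det (mat n n (\<lambda>(i, j). f i (j + of_bool (j \<in> S))))) =
      (\<Sum>S\<in>{?T}. det (mat n n (\<lambda>(i, j). f i (j + of_bool (j \<in> S)))))"
    using T by (intro sum.mono_neutral_right) auto
  also have "\<dots> = det (mat n n (\<lambda>(i, j). f i (if j < n - k then j else Suc j)))"
    by (auto intro!: arg_cong[of _ _ det] eq_matI)
  finally show ?thesis .
qed

text \<open>Bordering turns the minor into a full determinant, to which the multiplication rule
  applies. The sign \<open>(- 1) ^ k\<close> compensates the sign of the cofactor at
  \<open>(n, n - k)\<close>.\<close>

lemma det_unit_last_row:
  fixes f :: "nat \<Rightarrow> nat \<Rightarrow> 'r::comm_ring_1"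
  assumes "k \<le> n"
  shows "det (mat (Suc n) (Suc n) (\<lambda>(i, j). if i < n then f i j else (- 1) ^ k * of_bool (j = n - k))) =
    det (mat n n (\<lambda>(i, j). f i (if j < n - k then j else Suc j)))"
proof -
  let ?M = "mat (Suc n) (Suc n) (\<lambda>(i, j). if i < n then f i j else (- 1) ^ k * of_bool (j = n - k))"
  have "det ?M = (\<Sum>j<Suc n. ?M $$ (n, j) * cofactor ?M n j)"
    by (rule laplace_expansion_row[OF mat_carrier]) simp
  also have "\<dots> = (\<Sum>j\<in>{n - k}. ?M $$ (n, j) * cofactor ?M n j)"
    by (rule sum.mono_neutral_right) auto
  also have "\<dots> = (- 1) ^ k * (- 1) ^ (n + (n - k)) * det (mat_delete ?M n (n - k))"
    by (simp add: cofactor_def)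
  also have "(- 1) ^ k * (- 1) ^ (n + (n - k)) = (1 :: 'r)"
  proof -
    have "k + (n + (n - k)) = 2 * n" using assms by simp
    then show ?thesis by (metis power_add power_minus1_even)
  qed
  also have "mat_delete ?M n (n - k) = mat n n (\<lambda>(i, j). f i (if j < n - k then j else Suc j))"
    by (rule eq_matI) (auto simp: mat_delete_def)
  finally show ?thesis by simp
qed

lemma prod_list_neutral: "(\<And>x. x \<in> set xs \<Longrightarrow> x = 1) \<Longrightarrow> prod_list xs = (1 :: 'a::monoid_mult)"
  by (induction xs) auto

section \<open>The Pieri rule for Jacobi--Trudi determinants\<close>

locale elem_complete =
  fixes E H :: "nat \<Rightarrow> 'r::idom"
  assumes E_0: "E 0 = 1" and H_0: "H 0 = 1"
    and E_H: "0 < k \<Longrightarrow> (\<Sum>i\<le>k. (- 1) ^ i * (E i * H (k - i))) = 0"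
begin

definition Ez :: "int \<Rightarrow> 'r" where
  "Ez z = (if z < 0 then 0 else E (nat z))"

definition JT :: "nat \<Rightarrow> (nat \<Rightarrow> nat) \<Rightarrow> 'r" where
  "JT n a = det (mat n n (\<lambda>(i, j). Ez (int (a i) + int j - int i)))"

lemma JT_eq_0:
  assumes "a (Suc i) = Suc (a i)" "Suc i < n"
  shows "JT n a = 0"
  unfolding JT_def
  by (rule det_identical_rows[OF mat_carrier, of i "Suc i"]) (use assms in \<open>auto intro!: eq_vecI arg_cong[of _ _ Ez]\<close>)

lemma E_H_signed: "(\<Sum>i\<le>k. E i * ((- 1) ^ (k - i) * H (k - i))) = of_bool (k = 0)"
proof (cases "k = 0")
  case False
  have "(\<Sum>i\<le>k. E i * ((- 1) ^ (k - i) * H (k - i))) = (\<Sum>i\<le>k. (- 1) ^ k * ((- 1) ^ i * (E i * H (k - i))))"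
  proof (rule sum.cong)
    fix i assume "i \<in> {..k}"
    then have "(- 1) ^ k * (- 1) ^ i = ((- 1) ^ (k - i) :: 'r)"
      by (metis atMost_iff diff_add_inverse2 le_add_diff_inverse minus_one_power_iff power_add even_add even_diff_nat)
    then show "E i * ((- 1) ^ (k - i) * H (k - i)) = (- 1) ^ k * ((- 1) ^ i * (E i * H (k - i)))"
      by (metis mult.assoc mult.left_commute)
  qed simp
  then show ?thesis using E_H[of k] False by (simp flip: sum_distrib_left)
qed (simp add: E_0 H_0)

text \<open>The inverse of the unitriangular matrix with entries \<open>E (j - i)\<close>, which turns the rows
  beyond the support of a partition into unit vectors.\<close>

definition inv_entry :: "nat \<Rightarrow> nat \<Rightarrow> 'r" where
  "inv_entry j l = (if j \<le> l then (- 1) ^ (l - j) * H (l - j) else 0)"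

text \<open>The upper left block of the Jacobi--Trudi matrix times the matrix of
  \<open>inv_entry\<close>. It depends on neither the matrix size nor a left-out column, so
  different determinants can be compared through it.\<close>

definition corner :: "nat \<Rightarrow> (nat \<Rightarrow> nat) \<Rightarrow> 'r mat" where
  "corner t a = mat t t (\<lambda>(i, l). \<Sum>j\<le>l. Ez (int (a i) + int j - int i) * inv_entry j l)"

lemma E_inv_entry_unit: "(\<Sum>j\<le>l. Ez (int j - int i) * inv_entry j l) = of_bool (i = l)"
proof (cases "i \<le> l")
  case True
  have "(\<Sum>j\<le>l. Ez (int j - int i) * inv_entry j l) = (\<Sum>j=i..l. Ez (int j - int i) * inv_entry j l)"
    by (rule sum.mono_neutral_right) (auto simp: Ez_def)
  also have "\<dots> = (\<Sum>j=0+i..(l-i)+i. Ez (int j - int i) * inv_entry j l)"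
    using True by simp
  also have "\<dots> = (\<Sum>m=0..l-i. Ez (int (m + i) - int i) * inv_entry (m + i) l)"
    by (rule sum.shift_bounds_cl_nat_ivl)
  also have "\<dots> = (\<Sum>m\<le>l-i. E m * ((- 1) ^ (l - i - m) * H (l - i - m)))"
    using True by (intro sum.cong) (auto simp: Ez_def inv_entry_def atMost_atLeast0 add.commute)
  finally show ?thesis using E_H_signed[of "l - i"] True by auto
next
  case False
  then show ?thesis by (auto simp: Ez_def intro!: sum.neutral)
qed

text \<open>Multiply the bordered matrix by the unitriangular inverse. Rows \<open>t\<close> to
  \<open>n - 1\<close> become unit vectors, and the last row becomes row \<open>n - k\<close> of the
  inverse up to sign. As \<open>t\<close> is at most \<open>n - k\<close>, the lower left block is
  zero, and the lower right one is triangular with diagonal 1, ..., 1, \<open>H k\<close>.\<close>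

lemma det_minor:
  assumes a: "\<And>i. t \<le> i \<Longrightarrow> a i = 0" and n: "t + k \<le> n"
  shows "det (mat n n (\<lambda>(i, j). Ez (int (a i) + int (if j < n - k then j else Suc j) - int i))) =
    det (corner t a) * H k"
proof -
  let ?N = "Suc n"
  define M where "M = mat ?N ?N (\<lambda>(i, j). if i < n then Ez (int (a i) + int j - int i)
    else (- 1) ^ k * of_bool (j = n - k))"
  define W where "W = mat ?N ?N (\<lambda>(j, l). inv_entry j l)"
  define B where "B = mat t (?N - t) (\<lambda>(i, l). (M * W) $$ (i, l + t))"
  define L where "L = mat (?N - t) (?N - t) (\<lambda>(i, l). (M * W) $$ (i + t, l + t))"
  have carr: "M \<in> carrier_mat ?N ?N" "W \<in> carrier_mat ?N ?N" by (simp_all add: M_def W_def)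
  have MV: "(M * W) $$ (i, l) = (\<Sum>j\<le>l. M $$ (i, j) * inv_entry j l)" if "i < ?N" "l < ?N" for i l
  proof -
    have "(M * W) $$ (i, l) = (\<Sum>j<?N. M $$ (i, j) * inv_entry j l)"
      using that by (simp add: M_def W_def scalar_prod_def atLeast0LessThan)
    also have "\<dots> = (\<Sum>j\<le>l. M $$ (i, j) * inv_entry j l)"
      using that by (intro sum.mono_neutral_right) (auto simp: inv_entry_def)
    finally show ?thesis .
  qed
  have row: "(M * W) $$ (i, l) = (\<Sum>j\<le>l. Ez (int (a i) + int j - int i) * inv_entry j l)" if "i < n" "l < ?N" for i l
    using that by (subst MV) (auto simp: M_def intro!: sum.cong)
  have unit: "(M * W) $$ (i, l) = of_bool (i = l)" if "t \<le> i" "i < n" "l < ?N" for i l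
    using that by (simp add: row a E_inv_entry_unit)
  have last: "(M * W) $$ (n, l) = (- 1) ^ k * inv_entry (n - k) l" if "l < ?N" for l
  proof -
    have "(M * W) $$ (n, l) = (\<Sum>j\<le>l. M $$ (n, j) * inv_entry j l)"
      using that by (intro MV) auto
    also have "\<dots> = (\<Sum>j\<le>l. if j = n - k then (- 1) ^ k * inv_entry (n - k) l else 0)"
      by (rule sum.cong) (use that in \<open>auto simp: M_def\<close>)
    also have "\<dots> = (- 1) ^ k * inv_entry (n - k) l"
      by (subst sum.delta) (auto simp: inv_entry_def)
    finally show ?thesis .
  qed
  have "det W = prod_list (diag_mat W)"
    by (rule det_upper_triangular[OF _ carr(2)]) (auto simp: W_def inv_entry_def)
  also have "\<dots> = 1"
    by (rule prod_list_neutral) (auto simp: diag_mat_def W_def inv_entry_def H_0)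
  finally have "det M = det (M * W)" using det_mult[OF carr] by simp
  also have "M * W = four_block_mat (corner t a) B (0\<^sub>m (?N - t) t) L"
  proof (rule eq_matI)
    fix i j assume ij: "i < dim_row (four_block_mat (corner t a) B (0\<^sub>m (?N - t) t) L)"
      "j < dim_col (four_block_mat (corner t a) B (0\<^sub>m (?N - t) t) L)"
    then have ij: "i < ?N" "j < ?N" using n by (auto simp: corner_def L_def)
    consider "i < t" "j < t" | "i < t" "t \<le> j" | "t \<le> i" "t \<le> j" | "t \<le> i" "j < t" "i < n" | "i = n" "t \<le> i" "j < t"
      using ij by linarith
    then show "(M * W) $$ (i, j) = four_block_mat (corner t a) B (0\<^sub>m (?N - t) t) L $$ (i, j)"
    proof cases
      case 1
      then show ?thesis using ij n row[of i j] by (simp add: corner_def L_def)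
    next
      case 2
      then show ?thesis using ij n by (simp add: corner_def L_def B_def)
    next
      case 3
      then show ?thesis using ij n by (simp add: corner_def L_def)
    next
      case 4
      then show ?thesis using ij n unit[of i j] by (simp add: corner_def L_def)
    next
      case 5
      then show ?thesis using ij n last[of j] by (simp add: corner_def L_def inv_entry_def)
    qed
  qed (use n in \<open>auto simp: corner_def L_def M_def W_def\<close>)
  also have "det (four_block_mat (corner t a) B (0\<^sub>m (?N - t) t) L) = det (corner t a) * det L"
    by (rule det_four_block_mat_lower_left_zero) (auto simp: corner_def B_def L_def)
  also have "det L = prod_list (diag_mat L)"
  proof (rule det_lower_triangular)
    fix i j assume "i < j" "j < ?N - t"
    then show "L $$ (i, j) = 0" using unit[of "i + t" "j + t"] by (simp add: L_def)
  qed (simp add: L_def)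
  also have "diag_mat L = map (\<lambda>i. if i < n - t then 1 else H k) [0..<Suc (n - t)]"
  proof -
    have "L $$ (i, i) = (if i < n - t then 1 else H k)" if "i < Suc (n - t)" for i
    proof (cases "i < n - t")
      case True
      then show ?thesis using unit[of "i + t" "i + t"] by (simp add: L_def)
    next
      case False
      then have "i = n - t" using that by simp
      moreover have "(- 1) ^ k * ((- 1) ^ k * H k) = H k"
        by (simp flip: mult.assoc power_mult_distrib)
      ultimately show ?thesis using last[of n] n by (simp add: L_def inv_entry_def)
    qed
    then show ?thesis using n by (auto simp: diag_mat_def L_def Suc_diff_le simp del: upt_Suc)
  qed
  also have "prod_list \<dots> = H k"
  proof -
    have "prod_list (map (\<lambda>i. if i < n - t then 1 else H k) [0..<n - t]) = 1"
      by (rule prod_list_neutral) auto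
    then show ?thesis by simp
  qed
  finally have "det M = det (corner t a) * H k" .
  moreover have "det M = det (mat n n (\<lambda>(i, j). Ez (int (a i) + int (if j < n - k then j else Suc j) - int i)))"
    unfolding M_def using n by (subst det_unit_last_row) auto
  ultimately show ?thesis by simp
qed

text \<open>For \<open>k = 0\<close> the left-out column is the extra one, and the second factor is
  \<open>H 0 = 1\<close>.\<close>

lemma JT_eq_corner:
  assumes "\<And>i. t \<le> i \<Longrightarrow> a i = 0" "t \<le> n"
  shows "JT n a = det (corner t a)"
proof -
  have "JT n a = det (mat n n (\<lambda>(i, j). Ez (int (a i) + int (if j < n - 0 then j else Suc j) - int i)))"
    unfolding JT_def by (intro arg_cong[of _ _ det] eq_matI) auto
  also have "\<dots> = det (corner t a) * H 0"
    by (rule det_minor) (use assms in auto)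
  finally show ?thesis by (simp add: H_0)
qed

lemma JT_stable:
  assumes "\<And>i. t \<le> i \<Longrightarrow> a i = 0" "t \<le> n"
  shows "JT n a = JT t a"
  using JT_eq_corner[of t a n] JT_eq_corner[of t a t] assms by simp

text \<open>Raising \<open>a i\<close> by one shifts row \<open>i\<close> by one column. The sum of
  row shifts is a sum of column shifts, which collapses to one minor.\<close>

lemma JT_pieri:
  assumes "\<And>i. t \<le> i \<Longrightarrow> a i = 0" "t + k \<le> n"
  shows "(\<Sum>S | S \<subseteq> {..<n} \<and> card S = k. JT n (\<lambda>i. a i + of_bool (i \<in> S))) = H k * JT n a"
proof -
  let ?f = "\<lambda>i j. Ez (int (a i) + int j - int i)"
  have "JT n (\<lambda>i. a i + of_bool (i \<in> S)) = det (mat n n (\<lambda>(i, j). ?f i (j + of_bool (i \<in> S))))" for S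
    unfolding JT_def by (intro arg_cong[of _ _ det] eq_matI) (auto simp: algebra_simps)
  then have "(\<Sum>S | S \<subseteq> {..<n} \<and> card S = k. JT n (\<lambda>i. a i + of_bool (i \<in> S))) =
      (\<Sum>S | S \<subseteq> {..<n} \<and> card S = k. det (mat n n (\<lambda>(i, j). ?f i (j + of_bool (j \<in> S)))))"
    by (simp only: sum_det_shift_rows[where f = ?f])
  also have "\<dots> = det (mat n n (\<lambda>(i, j). ?f i (if j < n - k then j else Suc j)))"
    using assms(2) by (intro sum_det_shift_columns) simp
  also have "\<dots> = det (corner t a) * H k"
    by (rule det_minor) (use assms in auto)
  also have "det (corner t a) = JT n a"
    using JT_eq_corner[of t a n] assms by simp
  finally show ?thesis by (simp add: mult.commute)
qed

end

section \<open>Semistandard fillings\<close>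

definition cells :: "(nat \<Rightarrow> nat) \<Rightarrow> (nat \<times> nat) set" where
  "cells a = {(r, c). r < a c}"

definition fillings :: "(nat \<times> nat) set \<Rightarrow> (nat \<Rightarrow>\<^sub>0 nat) \<Rightarrow> (nat \<times> nat \<Rightarrow> nat) set" where
  "fillings D m = {T \<in> D \<rightarrow>\<^sub>E UNIV.
     (\<forall>r c c'. (r, c) \<in> D \<and> (r, c') \<in> D \<and> c < c' \<longrightarrow> T (r, c) \<le> T (r, c')) \<and>
     (\<forall>r r' c. (r, c) \<in> D \<and> (r', c) \<in> D \<and> r < r' \<longrightarrow> T (r, c) < T (r', c)) \<and>
     (\<Sum>b\<in>D. Poly_Mapping.single (T b) 1) = m}"

text \<open>Partitions are handled through their column lengths, so that adding a horizontal strip means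
  raising some of the values by one.\<close>

definition shape :: "(nat \<Rightarrow> nat) \<Rightarrow> bool" where
  "shape a \<longleftrightarrow> antimono a \<and> finite {c. a c \<noteq> 0}"

text \<open>The outer shape \<open>a\<close> comes before the inner shape \<open>a'\<close>.\<close>

definition strip :: "nat \<Rightarrow> (nat \<Rightarrow> nat) \<Rightarrow> (nat \<Rightarrow> nat) \<Rightarrow> bool" where
  "strip k a a' \<longleftrightarrow> antimono a' \<and> (\<forall>c. a' c \<le> a c \<and> a c \<le> Suc (a' c)) \<and> card {c. a c \<noteq> a' c} = k"

lemma in_cells [simp]: "(r, c) \<in> cells a \<longleftrightarrow> r < a c"
  by (simp add: cells_def)

lemma finite_cells: "finite {c. a c \<noteq> 0} \<Longrightarrow> finite (cells a)"
proof -
  assume "finite {c. a c \<noteq> 0}"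
  then have "finite (\<Union>c\<in>{c. a c \<noteq> 0}. (\<lambda>r. (r, c)) ` {..<a c})" by blast
  moreover have "cells a \<subseteq> (\<Union>c\<in>{c. a c \<noteq> 0}. (\<lambda>r. (r, c)) ` {..<a c})"
    by (force simp: cells_def)
  ultimately show ?thesis by (rule finite_subset[rotated])
qed

lemma finite_support_mono: "finite {c. a c \<noteq> 0} \<Longrightarrow> (\<And>c. a' c \<le> a c) \<Longrightarrow> finite {c. a' c \<noteq> (0::nat)}"
  by (erule finite_subset[rotated]) (metis (mono_tags, lifting) Collect_mono le_zero_eq)

lemma strip_shape: "shape a \<Longrightarrow> strip k a a' \<Longrightarrow> shape a'"
  using finite_support_mono[of a a'] by (auto simp: shape_def strip_def)

lemma content_iff:
  assumes "finite D"
  shows "(\<Sum>b\<in>D. Poly_Mapping.single (T b) (1 :: nat)) = m \<longleftrightarrow>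
    (\<forall>i. card {b \<in> D. T b = i} = Poly_Mapping.lookup m i)"
proof -
  have "Poly_Mapping.lookup (\<Sum>b\<in>D. Poly_Mapping.single (T b) (1 :: nat)) i = card {b \<in> D. T b = i}" for i
    using assms by (simp add: lookup_sum lookup_single when_def sum.If_cases Int_def)
  then show ?thesis by (auto simp: poly_mapping_eq_iff fun_eq_iff)
qed

lemma fillings_content:
  assumes "finite D" "T \<in> fillings D m"
  shows "card {b \<in> D. T b = i} = Poly_Mapping.lookup m i"
  using assms content_iff[of D T m] by (auto simp: fillings_def)

lemma fillings_in_keys:
  assumes "finite D" "T \<in> fillings D m" "b \<in> D"
  shows "T b \<in> Poly_Mapping.keys m"
proof -
  have "finite {b' \<in> D. T b' = T b}" "b \<in> {b' \<in> D. T b' = T b}" using assms by simp_all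
  then have "card {b' \<in> D. T b' = T b} > 0" by (metis card_gt_0_iff empty_iff)
  then show ?thesis using fillings_content[OF assms(1,2)] by (simp add: in_keys_iff)
qed

lemma finite_fillings: "finite D \<Longrightarrow> finite (fillings D m)"
proof (rule finite_subset)
  assume D: "finite D"
  show "fillings D m \<subseteq> D \<rightarrow>\<^sub>E Poly_Mapping.keys m"
  proof
    fix T assume T: "T \<in> fillings D m"
    then have "T \<in> extensional D" by (simp add: fillings_def PiE_iff)
    then show "T \<in> D \<rightarrow>\<^sub>E Poly_Mapping.keys m"
      using fillings_in_keys[OF D T] by (simp add: PiE_iff)
  qed
  show "finite (D \<rightarrow>\<^sub>E Poly_Mapping.keys m)" using D by (intro finite_PiE) auto
qed

lemma finite_strips:
  assumes "finite {c. a c \<noteq> 0}" shows "finite {a'. strip k a a'}"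
proof (rule finite_subset)
  let ?S = "{c. a c \<noteq> 0}"
  show "{a'. strip k a a'} \<subseteq> {f. \<forall>x. (x \<in> ?S \<longrightarrow> f x \<in> (\<Union>c\<in>?S. {..a c})) \<and> (x \<notin> ?S \<longrightarrow> f x = 0)}"
    by (auto simp: strip_def) (metis le_zero_eq)
  show "finite {f. \<forall>x. (x \<in> ?S \<longrightarrow> f x \<in> (\<Union>c\<in>?S. {..a c})) \<and> (x \<notin> ?S \<longrightarrow> f x = 0)}"
    using assms by (intro finite_set_of_finite_funs) auto
qed

lemma downclosed_eq_lessThan:
  assumes "finite A" "\<And>r r'. r' \<in> A \<Longrightarrow> r < r' \<Longrightarrow> r \<in> A"
  shows "A = {..<card A}"
proof (cases "A = {}")
  case False
  have "A = {..Max A}"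
  proof
    have Max: "Max A \<in> A" using assms(1) False by (rule Max_in)
    show "A \<subseteq> {..Max A}" using assms(1) by auto
    show "{..Max A} \<subseteq> A" using assms(2)[OF Max] Max by (auto simp: le_less)
  qed
  then show ?thesis by (metis card_atMost lessThan_Suc_atMost)
qed simp

lemma card_added_cells:
  assumes "\<And>c. a' c \<le> a c \<and> a c \<le> Suc (a' c)"
  shows "card (cells a - cells a') = card {c. a c \<noteq> a' c}"
proof -
  have "x \<in> cells a - cells a' \<longleftrightarrow> x \<in> (\<lambda>c. (a' c, c)) ` {c. a c \<noteq> a' c}" for x
  proof (cases x)
    case (Pair r c)
    have "r < a c \<and> \<not> r < a' c \<longleftrightarrow> r = a' c \<and> a c \<noteq> a' c" using assms[of c] by linarith
    then show ?thesis using Pair by auto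
  qed
  then have "cells a - cells a' = (\<lambda>c. (a' c, c)) ` {c. a c \<noteq> a' c}" by blast
  then show ?thesis by (simp add: card_image inj_on_def)
qed

section \<open>Removing the largest entry of a semistandard filling\<close>

definition lower_shape :: "nat \<Rightarrow> (nat \<Rightarrow> nat) \<Rightarrow> (nat \<times> nat \<Rightarrow> nat) \<Rightarrow> nat \<Rightarrow> nat" where
  "lower_shape n a T c = card {r. r < a c \<and> T (r, c) < n}"

definition extend_filling :: "nat \<Rightarrow> (nat \<Rightarrow> nat) \<Rightarrow> (nat \<Rightarrow> nat) \<Rightarrow> (nat \<times> nat \<Rightarrow> nat) \<Rightarrow> nat \<times> nat \<Rightarrow> nat" where
  "extend_filling n a a' T = restrict (\<lambda>b. if b \<in> cells a' then T b else n) (cells a)"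

context
  fixes n k :: nat and a :: "nat \<Rightarrow> nat" and m :: "nat \<Rightarrow>\<^sub>0 nat"
  assumes a: "shape a" and m: "Poly_Mapping.keys m \<subseteq> {..<n}"
begin

lemma fin_a: "finite (cells a)"
  using a by (simp add: shape_def finite_cells)

lemma lookup_max: "Poly_Mapping.lookup (m + Poly_Mapping.single n k) i =
    (if i < n then Poly_Mapping.lookup m i else if i = n then k else 0)"
proof -
  have "Poly_Mapping.lookup m i = 0" if "\<not> i < n" using m that by (metis in_keys_iff lessThan_iff subsetD)
  then show ?thesis by (auto simp: lookup_add lookup_single when_def)
qed

text \<open>Column strictness makes the entries below \<open>n\<close> an initial part of each
  column and leaves at most one entry \<open>n\<close> beneath them; weak rows make the remaining
  column lengths decrease. So the entries \<open>n\<close> occupy a horizontal strip.\<close>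

lemma remove_max:
  assumes T: "T \<in> fillings (cells a) (m + Poly_Mapping.single n k)"
  defines "a' \<equiv> lower_shape n a T"
  shows "strip k a a'" "restrict T (cells a') \<in> fillings (cells a') m"
    "extend_filling n a a' (restrict T (cells a')) = T"
proof -
  have mono: "a c' \<le> a c" if "c \<le> c'" for c c' using a that by (auto simp: shape_def antimono_def)
  have row: "T (r, c) \<le> T (r, c')" if "r < a c'" "c < c'" for r c c'
    using T that mono[of c c'] unfolding fillings_def by force
  have col: "T (r, c) < T (r', c)" if "r' < a c" "r < r'" for r r' c
    using T that unfolding fillings_def by force
  have le: "T (r, c) \<le> n" if "r < a c" for r c
  proof -
    have "T (r, c) \<in> Poly_Mapping.keys (m + Poly_Mapping.single n k)"
      using that by (intro fillings_in_keys[OF fin_a T]) simp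
    then show ?thesis using lookup_max[of "T (r, c)"] by (auto simp: in_keys_iff split: if_splits)
  qed
  have low: "r < a' c \<longleftrightarrow> r < a c \<and> T (r, c) < n" for r c
  proof -
    have "{r. r < a c \<and> T (r, c) < n} = {..<a' c}"
      unfolding a'_def lower_shape_def
    proof (rule downclosed_eq_lessThan)
      fix r r' assume "r' \<in> {r. r < a c \<and> T (r, c) < n}" "r < r'"
      then show "r \<in> {r. r < a c \<and> T (r, c) < n}" using col[of r' c r] by auto
    qed simp
    then show ?thesis by blast
  qed
  have le_a: "a' c \<le> a c" for c
    using low[of "a c" c] by (meson less_irrefl not_le)
  have ge_a: "a c \<le> Suc (a' c)" for c
  proof (rule ccontr)
    assume "\<not> a c \<le> Suc (a' c)"
    then have "Suc (a' c) < a c" by simp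
    then show False using low[of "a' c" c] col[of "Suc (a' c)" c "a' c"] le[of "Suc (a' c)" c] by simp
  qed
  have anti: "antimono a'"
  proof (rule antimonoI, rule ccontr)
    fix c c' :: nat assume "c \<le> c'" "\<not> a' c' \<le> a' c"
    then have "c < c'" "a' c < a' c'" by (auto simp: le_less)
    then show False using low[of "a' c" c] low[of "a' c" c'] row[of "a' c" c' c] mono[of c c'] by auto
  qed
  have sub: "cells a' \<subseteq> cells a" using low by (auto simp: cells_def)
  have fin': "finite (cells a')" using sub fin_a finite_subset by blast
  have low': "b \<in> cells a' \<longleftrightarrow> b \<in> cells a \<and> T b < n" for b
    by (cases b) (simp add: low)
  have "{b \<in> cells a. T b = n} = cells a - cells a'"
  proof -
    have "T b \<le> n" if "b \<in> cells a" for b using le that by (cases b) simp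
    then show ?thesis using low' by (auto simp: le_less)
  qed
  then have "card (cells a - cells a') = k"
    using fillings_content[OF fin_a T, of n] by (simp add: lookup_max)
  then show "strip k a a'"
    using anti le_a ge_a card_added_cells[of a' a] by (simp add: strip_def)
  have "card {b \<in> cells a'. restrict T (cells a') b = i} = Poly_Mapping.lookup m i" for i
  proof (cases "i < n")
    case True
    then have "{b \<in> cells a'. restrict T (cells a') b = i} = {b \<in> cells a. T b = i}"
      using low' by auto
    then show ?thesis using fillings_content[OF fin_a T, of i] True by (simp add: lookup_max)
  next
    case False
    then have "{b \<in> cells a'. restrict T (cells a') b = i} = {}" using low' by auto
    moreover have "Poly_Mapping.lookup m i = 0" using m False by (metis in_keys_iff lessThan_iff subsetD)
    ultimately show ?thesis by (simp only: card.empty)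
  qed
  then have "(\<Sum>b\<in>cells a'. Poly_Mapping.single (restrict T (cells a') b) 1) = m"
    unfolding content_iff[OF fin'] by blast
  then show "restrict T (cells a') \<in> fillings (cells a') m"
    using row col low by (auto simp: fillings_def)
  show "extend_filling n a a' (restrict T (cells a')) = T"
  proof
    fix b
    show "extend_filling n a a' (restrict T (cells a')) b = T b"
    proof (cases "b \<in> cells a")
      case True
      then have "T b \<le> n" using le by (cases b) simp
      then show ?thesis using True by (simp add: extend_filling_def low')
    next
      case False
      moreover have "T b = undefined" using False T unfolding fillings_def by (blast intro: PiE_arb)
      ultimately show ?thesis by (simp add: extend_filling_def)
    qed
  qed
qed

text \<open>An added cell is the last of its column and \<open>n\<close> exceeds all old entries, so
  columns stay strict. Left of an old cell there are only old cells, so rows stay weak.\<close>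

lemma add_max:
  assumes a': "strip k a a'" and T: "T \<in> fillings (cells a') m"
  shows "extend_filling n a a' T \<in> fillings (cells a) (m + Poly_Mapping.single n k)"
    "lower_shape n a (extend_filling n a a' T) = a'"
    "restrict (extend_filling n a a' T) (cells a') = T"
proof -
  let ?T = "extend_filling n a a' T"
  have a'le: "a' c \<le> a c" "a c \<le> Suc (a' c)" for c using a' by (auto simp: strip_def)
  have mono: "a' c' \<le> a' c" if "c \<le> c'" for c c' using a' that by (auto simp: strip_def antimono_def)
  have sub: "cells a' \<subseteq> cells a" using a'le(1) by (auto simp: cells_def intro: less_le_trans)
  have fin': "finite (cells a')" using sub fin_a finite_subset by blast
  have less: "T b < n" if "b \<in> cells a'" for b
    using fillings_in_keys[OF fin' T that] m by auto
  have row: "T (r, c) \<le> T (r, c')" if "r < a' c'" "c < c'" for r c c'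
    using T that mono[of c c'] unfolding fillings_def by force
  have col: "T (r, c) < T (r', c)" if "r' < a' c" "r < r'" for r r' c
    using T that unfolding fillings_def by force
  have eq: "?T (r, c) = (if r < a' c then T (r, c) else n)" if "r < a c" for r c
    using that by (simp add: extend_filling_def)
  have eq': "?T b = (if b \<in> cells a' then T b else n)" if "b \<in> cells a" for b
    using that by (simp add: extend_filling_def)
  have 1: "?T (r, c) \<le> ?T (r, c')" if "r < a c" "r < a c'" "c < c'" for r c c'
    using row[of r c' c] mono[of c c'] less[of "(r, c)"] that by (auto simp: eq)
  have 2: "?T (r, c) < ?T (r', c)" if "r < a c" "r' < a c" "r < r'" for r r' c
    using col[of r' c r] a'le(2)[of c] less[of "(r, c)"] that by (auto simp: eq)
  have "card {b \<in> cells a. ?T b = i} = Poly_Mapping.lookup (m + Poly_Mapping.single n k) i" for i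
  proof -
    consider "i < n" | "i = n" | "i > n" by linarith
    then show ?thesis
    proof cases
      case 1
      then have "{b \<in> cells a. ?T b = i} = {b \<in> cells a'. T b = i}"
        using sub by (auto simp: eq' split: if_splits)
      then show ?thesis using 1 fillings_content[OF fin' T] by (simp add: lookup_max)
    next
      case 2
      then have "{b \<in> cells a. ?T b = i} = cells a - cells a'"
        using less by (force simp: eq' split: if_splits)
      then show ?thesis using 2 card_added_cells[of a' a] a' by (simp add: lookup_max strip_def)
    next
      case 3
      then have "{b \<in> cells a. ?T b = i} = {}"
        using less by (force simp: eq' split: if_splits)
      then have "card {b \<in> cells a. ?T b = i} = 0" by (simp only: card.empty)
      then show ?thesis using 3 by (simp add: lookup_max)
    qed
  qed
  then have "(\<Sum>b\<in>cells a. Poly_Mapping.single (?T b) 1) = m + Poly_Mapping.single n k"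
    unfolding content_iff[OF fin_a] by blast
  then show "?T \<in> fillings (cells a) (m + Poly_Mapping.single n k)"
    using 1 2 by (auto simp: fillings_def extend_filling_def)
  show "lower_shape n a ?T = a'"
  proof
    fix c
    have "{r. r < a c \<and> ?T (r, c) < n} = {..<a' c}"
      using a'le(1)[of c] less by (auto simp: eq split: if_splits)
    then show "lower_shape n a ?T c = a' c" by (simp add: lower_shape_def)
  qed
  show "restrict ?T (cells a') = T"
  proof
    fix b
    have "T b = undefined" if "b \<notin> cells a'" using that T unfolding fillings_def by (blast intro: PiE_arb)
    then show "restrict ?T (cells a') b = T b"
      using sub by (cases "b \<in> cells a'") (auto simp: eq')
  qed
qed

text \<open>The recursion of the Kostka numbers that removes the last part of the content.\<close>

lemma card_fillings_add_max:
  "card (fillings (cells a) (m + Poly_Mapping.single n k)) =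
   (\<Sum>a' | strip k a a'. card (fillings (cells a') m))"
proof -
  let ?F = "\<lambda>T. (lower_shape n a T, restrict T (cells (lower_shape n a T)))"
  let ?G = "\<lambda>(a', T). extend_filling n a a' T"
  have "bij_betw ?F (fillings (cells a) (m + Poly_Mapping.single n k))
      (SIGMA a':{a'. strip k a a'}. fillings (cells a') m)"
    by (rule bij_betw_byWitness[of _ ?G]) (auto simp: remove_max add_max)
  then have "card (fillings (cells a) (m + Poly_Mapping.single n k)) =
      card (SIGMA a':{a'. strip k a a'}. fillings (cells a') m)"
    by (rule bij_betw_same_card)
  also have "\<dots> = (\<Sum>a' | strip k a a'. card (fillings (cells a') m))"
  proof (rule card_SigmaI)
    show "finite {a'. strip k a a'}" using a by (intro finite_strips) (simp add: shape_def)
    show "\<forall>a'\<in>{a'. strip k a a'}. finite (fillings (cells a') m)"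
      using strip_shape[OF a] by (auto simp: shape_def intro!: finite_fillings finite_cells)
  qed
  finally show ?thesis .
qed

end

lemma card_fillings_0:
  assumes "shape a"
  shows "card (fillings (cells a) 0) = of_bool (a = (\<lambda>_. 0))"
proof (cases "a = (\<lambda>_. 0)")
  case True
  then have "cells a = {}" by (auto simp: cells_def)
  then have "fillings (cells a) 0 = {\<lambda>_. undefined}" by (auto simp: fillings_def)
  then show ?thesis using True by simp
next
  case False
  then obtain c where "a c \<noteq> 0" by auto
  then have "(0, c) \<in> cells a" by simp
  then have "fillings (cells a) 0 = {}"
    using fillings_in_keys[of "cells a" _ 0 "(0, c)"] assms by (auto simp: shape_def finite_cells)
  then show ?thesis using False by simp
qed

section \<open>Finiteness of the set of contributing shapes\<close>

definition total :: "(nat \<Rightarrow>\<^sub>0 nat) \<Rightarrow> nat" where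
  "total m = (\<Sum>i\<in>Poly_Mapping.keys m. Poly_Mapping.lookup m i)"

lemma fillings_card_cells:
  assumes "finite D" "T \<in> fillings D m" shows "card D = total m"
proof -
  have "card D = (\<Sum>i\<in>Poly_Mapping.keys m. card {b \<in> D. T b = i})"
  proof -
    have "T ` D \<subseteq> Poly_Mapping.keys m" using fillings_in_keys[OF assms] by blast
    then have "(\<Sum>i\<in>Poly_Mapping.keys m. sum (\<lambda>_. 1) {b \<in> D. T b = i}) = sum (\<lambda>_. 1 :: nat) D"
      using assms(1) by (intro sum.group) auto
    then show ?thesis by simp
  qed
  then show ?thesis by (simp add: total_def fillings_content[OF assms])
qed

text \<open>Shapes inside a square of side \<open>d\<close>. This finite set contains every shape
  that has a filling of a content of size at most \<open>d\<close>.\<close>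

definition bounded_shapes :: "nat \<Rightarrow> (nat \<Rightarrow> nat) set" where
  "bounded_shapes d = {a. antimono a \<and> (\<forall>i\<ge>d. a i = 0) \<and> (\<forall>i. a i \<le> d)}"

lemma bounded_shapes_shape: "a \<in> bounded_shapes d \<Longrightarrow> shape a"
proof -
  assume "a \<in> bounded_shapes d"
  moreover from this have "{c. a c \<noteq> 0} \<subseteq> {..<d}"
    by (force simp: bounded_shapes_def not_less[symmetric])
  ultimately show ?thesis by (auto simp: shape_def bounded_shapes_def intro: finite_subset)
qed

lemma finite_bounded_shapes: "finite (bounded_shapes d)"
proof (rule finite_subset)
  show "bounded_shapes d \<subseteq> {f. \<forall>x. (x \<in> {..<d} \<longrightarrow> f x \<in> {..d}) \<and> (x \<notin> {..<d} \<longrightarrow> f x = 0)}"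
    by (auto simp: bounded_shapes_def)
  show "finite {f. \<forall>x. (x \<in> {..<d} \<longrightarrow> f x \<in> {..d}) \<and> (x \<notin> {..<d} \<longrightarrow> f x = (0::nat))}"
    by (intro finite_set_of_finite_funs) auto
qed

lemma fillings_bounded:
  assumes a: "shape a" and T: "T \<in> fillings (cells a) m"
  shows "a \<in> bounded_shapes (total m)"
proof -
  have fin: "finite (cells a)" using a by (simp add: shape_def finite_cells)
  have tot: "card (cells a) = total m" by (rule fillings_card_cells[OF fin T])
  have anti: "antimono a" using a by (simp add: shape_def)
  have "a i = 0" if "total m \<le> i" for i
  proof (rule ccontr)
    assume "a i \<noteq> 0"
    then have "0 < a j" if "j \<le> i" for j using antimonoD[OF anti that] by simp
    then have "(\<lambda>j. (0, j)) ` {..i} \<subseteq> cells a" by auto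
    then have "card ((\<lambda>j. (0::nat, j)) ` {..i}) \<le> total m" using fin tot by (metis card_mono)
    then show False using that by (simp add: card_image inj_on_def)
  qed
  moreover have "a i \<le> total m" for i
  proof -
    have "(\<lambda>r. (r, i)) ` {..<a i} \<subseteq> cells a" by auto
    then have "card ((\<lambda>r. (r, i)) ` {..<a i}) \<le> total m" using fin tot by (metis card_mono)
    then show ?thesis by (simp add: card_image inj_on_def)
  qed
  ultimately show ?thesis using anti by (simp add: bounded_shapes_def)
qed

lemma total_eq_sum:
  assumes "Poly_Mapping.keys m \<subseteq> {..<n}"
  shows "total m = (\<Sum>i<n. Poly_Mapping.lookup m i)"
  unfolding total_def using assms by (intro sum.mono_neutral_left) (auto simp: in_keys_iff)

context elem_complete
begin

text \<open>If adding \<open>S\<close> destroys monotonicity at \<open>i\<close>, then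
  \<open>a' (Suc i) = a' i\<close> with \<open>Suc i\<close> in \<open>S\<close> and
  \<open>i\<close> outside; two rows agree and the determinant vanishes. The other sets
  \<open>S\<close> are the horizontal strips, and \<open>t + k \<le> d\<close> leaves room for them
  in the square.\<close>

lemma JT_pieri_shapes:
  assumes a': "a' \<in> bounded_shapes t" and d: "t + k \<le> d"
  shows "(\<Sum>a | a \<in> bounded_shapes d \<and> strip k a a'. JT d a) = H k * JT d a'"
proof -
  let ?Ss = "{S. S \<subseteq> {..<d} \<and> card S = k}"
  let ?add = "\<lambda>S i. a' i + of_bool (i \<in> S)"
  let ?good = "{S \<in> ?Ss. antimono (?add S)}"
  have anti: "antimono a'" and supp: "\<And>i. t \<le> i \<Longrightarrow> a' i = 0" and bound: "\<And>i. a' i \<le> t"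
    using a' by (auto simp: bounded_shapes_def)
  have fin: "finite ?Ss" by (rule finite_subset[of _ "Pow {..<d}"]) auto
  have "JT d (?add S) = 0" if S: "S \<in> ?Ss" "\<not> antimono (?add S)" for S
  proof -
    obtain i where i: "?add S i < ?add S (Suc i)"
      using S(2) unfolding antimono_iff_le_Suc by (meson not_le)
    moreover have "a' (Suc i) \<le> a' i" using antimonoD[OF anti, of i "Suc i"] by simp
    ultimately have "?add S (Suc i) = Suc (?add S i)" by (auto split: if_splits simp: of_bool_def)
    moreover have "Suc i < d"
    proof (rule ccontr)
      assume "\<not> Suc i < d"
      then have "Suc i \<notin> S" "a' (Suc i) = 0" using S(1) supp d by auto
      then show False using i by simp
    qed
    ultimately show ?thesis by (rule JT_eq_0)
  qed
  then have "(\<Sum>S\<in>?Ss. JT d (?add S)) = (\<Sum>S\<in>?good. JT d (?add S))"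
    using fin by (intro sum.mono_neutral_right) auto
  also have "\<dots> = (\<Sum>a | a \<in> bounded_shapes d \<and> strip k a a'. JT d a)"
  proof (rule sum.reindex_bij_witness[of _ "\<lambda>a. {i. a i \<noteq> a' i}" ?add])
    fix S assume S: "S \<in> ?good"
    show S': "{i. ?add S i \<noteq> a' i} = S" by auto
    have "?add S i \<le> d" for i
    proof (cases "i \<in> S")
      case True
      \<comment> \<open>A raised column shows that \<open>k\<close> is positive, so the room for
        \<open>k\<close> cells covers the one added here.\<close>
      then have "0 < k" using S finite_subset[of S "{..<d}"] by (auto simp: card_gt_0_iff)
      then show ?thesis using bound[of i] d by simp
    qed (use bound[of i] d in simp)
    moreover have "?add S i = 0" if "d \<le> i" for i
      using that S supp[of i] d by auto
    ultimately show "?add S \<in> {a. a \<in> bounded_shapes d \<and> strip k a a'}"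
      using S anti S' by (simp add: bounded_shapes_def strip_def)
  next
    fix a assume a: "a \<in> {a. a \<in> bounded_shapes d \<and> strip k a a'}"
    have le: "a' i \<le> a i" "a i \<le> Suc (a' i)" for i using a by (auto simp: strip_def)
    show eq: "?add {i. a i \<noteq> a' i} = a"
    proof
      fix i show "?add {i. a i \<noteq> a' i} i = a i" using le[of i] by auto
    qed
    have "i < d" if "a i \<noteq> a' i" for i
    proof (rule ccontr)
      assume "\<not> i < d"
      then show False using that a supp[of i] d by (simp add: bounded_shapes_def)
    qed
    then show "{i. a i \<noteq> a' i} \<in> ?good"
      using a eq by (auto simp: strip_def bounded_shapes_def)
  qed simp
  finally show ?thesis using JT_pieri[of t a' k d] supp d by simp
qed

text \<open>The coefficients are Kostka numbers. Their recursion, after exchanging the two sums,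
  meets the Pieri rule. The side \<open>d\<close> stays fixed while \<open>m\<close> shrinks, so
  that all determinants have the same size.\<close>

lemma complete_expansion:
  assumes "Poly_Mapping.keys m \<subseteq> {..<n}" "total m \<le> d"
  shows "(\<Sum>a\<in>bounded_shapes d. of_nat (card (fillings (cells a) m)) * JT d a) =
    (\<Prod>i<n. H (Poly_Mapping.lookup m i))"
  using assms
proof (induction n arbitrary: m)
  case 0
  then have m: "m = 0" by (simp add: poly_mapping_eqI in_keys_iff)
  have "(\<lambda>_. 0) \<in> bounded_shapes d" by (simp add: bounded_shapes_def antimono_def)
  have "(\<Sum>a\<in>bounded_shapes d. of_nat (card (fillings (cells a) m)) * JT d a) =
      (\<Sum>a\<in>bounded_shapes d. of_bool (a = (\<lambda>_. 0)) * JT d a)"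
    by (intro sum.cong) (simp_all add: m card_fillings_0 bounded_shapes_shape)
  also have "\<dots> = (\<Sum>a\<in>{\<lambda>_. 0}. JT d a)"
    using \<open>(\<lambda>_. 0) \<in> bounded_shapes d\<close> finite_bounded_shapes
    by (intro sum.mono_neutral_cong_right) auto
  also have "\<dots> = JT 0 (\<lambda>_. 0)" using JT_stable[of 0 "\<lambda>_. 0" d] by simp
  also have "\<dots> = 1" by (simp add: JT_def)
  finally show ?case by simp
next
  case (Suc n)
  define k where "k = Poly_Mapping.lookup m n"
  define m' where "m' = Poly_Mapping.update n 0 m"
  have lookup': "Poly_Mapping.lookup m' i = (if i = n then 0 else Poly_Mapping.lookup m i)" for i
    by (simp add: m'_def Poly_Mapping.lookup_update)
  have m: "m = m' + Poly_Mapping.single n k"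
    by (rule poly_mapping_eqI) (auto simp: lookup' lookup_add lookup_single k_def when_def)
  have keys': "Poly_Mapping.keys m' \<subseteq> {..<n}"
  proof
    fix i assume "i \<in> Poly_Mapping.keys m'"
    then have "i \<noteq> n" "i \<in> Poly_Mapping.keys m" by (auto simp: in_keys_iff lookup' split: if_splits)
    then show "i \<in> {..<n}" using Suc.prems(1) by (auto simp: less_Suc_eq)
  qed
  have "total m = total m' + k"
    unfolding total_eq_sum[OF Suc.prems(1)] total_eq_sum[OF keys'] by (simp add: lookup' k_def)
  then have d: "total m' + k \<le> d" using Suc.prems(2) by simp
  let ?K = "\<lambda>a m. of_nat (card (fillings (cells a) m)) :: 'r"
  let ?B = "bounded_shapes d"
  have sub: "a' \<in> ?B" if a: "a \<in> ?B" and a': "strip k a a'" for a a'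
  proof -
    have le: "a' i \<le> a i" for i using a' by (simp add: strip_def)
    have "a' i = 0" if "d \<le> i" for i
      using le[of i] a that by (simp add: bounded_shapes_def)
    moreover have "a' i \<le> d" for i
      using le[of i] a by (auto simp: bounded_shapes_def intro: order_trans)
    ultimately show ?thesis using a' by (simp add: bounded_shapes_def strip_def)
  qed
  have "(\<Sum>a\<in>?B. ?K a m * JT d a) = (\<Sum>a\<in>?B. \<Sum>a' | a' \<in> ?B \<and> strip k a a'. ?K a' m' * JT d a)"
  proof (rule sum.cong)
    fix a assume a: "a \<in> ?B"
    have "{a'. strip k a a'} = {a'. a' \<in> ?B \<and> strip k a a'}" using sub[OF a] by blast
    then show "?K a m * JT d a = (\<Sum>a' | a' \<in> ?B \<and> strip k a a'. ?K a' m' * JT d a)"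
      unfolding m card_fillings_add_max[OF bounded_shapes_shape[OF a] keys']
      by (simp add: sum_distrib_right)
  qed simp
  also have "\<dots> = (\<Sum>a'\<in>?B. \<Sum>a | a \<in> ?B \<and> strip k a a'. ?K a' m' * JT d a)"
    using finite_bounded_shapes by (intro sum.swap_restrict)
  also have "\<dots> = (\<Sum>a'\<in>?B. H k * (?K a' m' * JT d a'))"
  proof (rule sum.cong)
    fix a' assume "a' \<in> ?B"
    show "(\<Sum>a | a \<in> ?B \<and> strip k a a'. ?K a' m' * JT d a) = H k * (?K a' m' * JT d a')"
    \<comment> \<open>The Pieri rule requires \<open>a'\<close> to lie in the square of side
      \<open>total m'\<close>. Outside it there is no filling, and both sides vanish.\<close>
    proof (cases "fillings (cells a') m' = {}")
      case False
      then have "a' \<in> bounded_shapes (total m')"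
        using fillings_bounded[OF bounded_shapes_shape[OF \<open>a' \<in> ?B\<close>]] by blast
      then have "(\<Sum>a | a \<in> ?B \<and> strip k a a'. JT d a) = H k * JT d a'"
        using d by (rule JT_pieri_shapes)
      then show ?thesis by (simp flip: sum_distrib_left)
    qed simp
  qed simp
  also have "\<dots> = H k * (\<Prod>i<n. H (Poly_Mapping.lookup m' i))"
    using Suc.IH[OF keys'] d by (simp flip: sum_distrib_left)
  also have "\<dots> = (\<Prod>i<Suc n. H (Poly_Mapping.lookup m i))"
    by (simp add: lookup' k_def mult.commute)
  finally show ?case .
qed

end

text \<open>The duality relation between \<open>E\<close> and \<open>H\<close>, solved for the term
  \<open>H\<close> of highest index.\<close>

fun complete_of_elem :: "(nat \<Rightarrow> 'r::comm_ring_1) \<Rightarrow> nat \<Rightarrow> 'r" where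
  "complete_of_elem E 0 = 1"
| "complete_of_elem E (Suc n) = (\<Sum>i\<le>n. (- 1) ^ i * (E (Suc i) * complete_of_elem E (n - i)))"

lemma elem_complete_of_elem:
  fixes E :: "nat \<Rightarrow> 'r::idom"
  assumes "E 0 = 1" shows "elem_complete E (complete_of_elem E)"
proof
  fix k :: nat assume "0 < k"
  then obtain n where k: "k = Suc n" using gr0_implies_Suc by blast
  have "(\<Sum>i\<le>k. (- 1) ^ i * (E i * complete_of_elem E (k - i))) =
      complete_of_elem E (Suc n) + (\<Sum>i\<le>n. (- 1) ^ Suc i * (E (Suc i) * complete_of_elem E (n - i)))"
    unfolding k by (subst sum.atMost_Suc_shift) (simp add: assms)
  then show "(\<Sum>i\<le>k. (- 1) ^ i * (E i * complete_of_elem E (k - i))) = 0"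
    by (simp add: sum_negf)
qed (simp_all add: assms)

section \<open>Fundamental quasisymmetric functions\<close>

abbreviation complete_word_sum :: "nat \<Rightarrow> nat \<Rightarrow> ncpoly" where
  "complete_word_sum N k \<equiv> chain_sum (\<lambda>x y. \<not> col_ge x y) (alphabet N) uvar k"

lemma prod_list_uvar: "prod_list (map uvar w) = Poly_Mapping.single w 1"
  by (induction w) (simp_all add: uvar_def mult_single ncpoly_one)

definition content_word :: "(nat \<Rightarrow>\<^sub>0 nat) \<Rightarrow> nat \<Rightarrow> nat list" where
  "content_word m n = concat (map (\<lambda>i. replicate (Poly_Mapping.lookup m i) i) [0..<n])"

text \<open>For a sorted index sequence: indices strictly increase at each descent of
  \<open>w\<close>. Stating this for neighbouring pairs lets it split along concatenations.\<close>

definition compatible :: "nat list \<Rightarrow> letter list \<Rightarrow> bool" where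
  "compatible is w \<longleftrightarrow> successively (\<lambda>(i, x) (j, y). i < j \<or> \<not> col_ge x y) (zip is w)"

lemma content_word_Suc:
  "content_word m (Suc n) = content_word m n @ replicate (Poly_Mapping.lookup m n) n"
  by (simp add: content_word_def)

lemma content_word_less: "i \<in> set (content_word m n) \<Longrightarrow> i < n"
  by (auto simp: content_word_def)

text \<open>At the seam the index rises to \<open>n\<close>, so nothing is required of the letters
  there. In the last block the indices are equal, so descents are excluded.\<close>

lemma compatible_append_replicate:
  assumes "length is = length w" "length w' = k" "\<And>i. i \<in> set is \<Longrightarrow> i < n"
  shows "compatible (is @ replicate k n) (w @ w') \<longleftrightarrow>
    compatible is w \<and> successively (\<lambda>x y. \<not> col_ge x y) w'"
proof -
  let ?P = "\<lambda>(i, x) (j, y). i < j \<or> \<not> col_ge x y"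
  have zip: "zip (is @ replicate k n) (w @ w') = zip is w @ map (Pair n) w'"
    using assms(1,2) by (simp add: zip_replicate1)
  have "?P (last (zip is w)) (hd (map (Pair n) w'))" if "zip is w \<noteq> []" "w' \<noteq> []"
  proof -
    have "last (zip is w) \<in> set (zip is w)" using that(1) by (rule last_in_set)
    then have "fst (last (zip is w)) < n" using assms(3) by (metis in_set_zipE prod.collapse)
    then show ?thesis using that(2) by (simp add: hd_map case_prod_beta)
  qed
  then show ?thesis
    unfolding compatible_def zip successively_append_iff
    by (auto simp: successively_map)
qed

lemma complete_word_sum_product:
  "prod_list (map (\<lambda>i. complete_word_sum N (Poly_Mapping.lookup m i)) [0..<n]) =
   (\<Sum>w | length w = length (content_word m n) \<and> set w \<subseteq> alphabet N \<and> compatible (content_word m n) w.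
      Poly_Mapping.single w 1)"
proof (induction n)
  case 0
  have "{w. length w = length (content_word m 0) \<and> set w \<subseteq> alphabet N \<and>
      compatible (content_word m 0) w} = {[]}"
    by (auto simp: content_word_def compatible_def)
  then show ?case by (simp add: ncpoly_one)
next
  case (Suc n)
  let ?k = "Poly_Mapping.lookup m n"
  let ?l = "length (content_word m n)"
  let ?X = "{w. length w = ?l \<and> set w \<subseteq> alphabet N \<and> compatible (content_word m n) w}"
  have less: "\<And>i. i \<in> set (content_word m n) \<Longrightarrow> i < n" by (rule content_word_less)
  let ?Y = "{w. length w = ?k \<and> set w \<subseteq> alphabet N \<and> successively (\<lambda>x y. \<not> col_ge x y) w}"
  have "prod_list (map (\<lambda>i. complete_word_sum N (Poly_Mapping.lookup m i)) [0..<Suc n]) =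
      (\<Sum>w\<in>?X. Poly_Mapping.single w 1) * (\<Sum>w\<in>?Y. Poly_Mapping.single w 1)"
    using Suc by (simp add: chain_sum_def prod_list_uvar)
  also have "\<dots> = (\<Sum>(w, w')\<in>?X \<times> ?Y. Poly_Mapping.single (w @ w') 1)"
    by (simp add: sum_product sum.cartesian_product mult_single)
  also have "\<dots> = (\<Sum>w | length w = length (content_word m (Suc n)) \<and> set w \<subseteq> alphabet N \<and>
      compatible (content_word m (Suc n)) w. Poly_Mapping.single w 1)"
  proof (rule sum.reindex_bij_witness[of _ "\<lambda>w. (take ?l w, drop ?l w)" "\<lambda>(w, w'). w @ w'"])
    fix w assume w: "w \<in> {w. length w = length (content_word m (Suc n)) \<and> set w \<subseteq> alphabet N \<and>
      compatible (content_word m (Suc n)) w}"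
    then have len: "length (take ?l w) = ?l" "length (drop ?l w) = ?k"
      by (simp_all add: content_word_Suc)
    have "compatible (content_word m n @ replicate ?k n) (take ?l w @ drop ?l w)"
      using w by (simp add: content_word_Suc)
    then have "compatible (content_word m n) (take ?l w)" "successively (\<lambda>x y. \<not> col_ge x y) (drop ?l w)"
      using compatible_append_replicate[OF len(1)[symmetric] len(2) less] by blast+
    then show "(take ?l w, drop ?l w) \<in> ?X \<times> ?Y"
      using w len by (auto dest: in_set_takeD in_set_dropD)
  next
    fix p assume p: "p \<in> ?X \<times> ?Y"
    then show "(case p of (w, w') \<Rightarrow> w @ w') \<in> {w. length w = length (content_word m (Suc n)) \<and>
        set w \<subseteq> alphabet N \<and> compatible (content_word m (Suc n)) w}"
      using compatible_append_replicate[of "content_word m n" "fst p" "snd p" ?k n, OF _ _ less]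
      by (auto simp: content_word_Suc)
  qed auto
  finally show ?case .
qed

lemma lookup_sum_list_single:
  "Poly_Mapping.lookup (sum_list (map (\<lambda>i. Poly_Mapping.single i (1 :: nat)) is)) j = count (mset is) j"
  by (induction "is") (auto simp: lookup_add lookup_single when_def)

lemma count_content_word:
  "count (mset (content_word m n)) j = (if j < n then Poly_Mapping.lookup m j else 0)"
  by (induction n) (auto simp: content_word_def less_Suc_eq)

lemma sorted_content_word: "sorted (content_word m n)"
proof (induction n)
  case (Suc n)
  then show ?case
    using content_word_less by (fastforce simp: content_word_Suc sorted_append sorted_replicate)
qed (simp add: content_word_def)

lemma sorted_content_unique:
  assumes "Poly_Mapping.keys m \<subseteq> {..<n}"
  shows "sorted is \<and> sum_list (map (\<lambda>i. Poly_Mapping.single i 1) is) = m \<longleftrightarrow> is = content_word m n"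
proof -
  have m: "Poly_Mapping.lookup m j = count (mset (content_word m n)) j" for j
    using assms by (auto simp: count_content_word in_keys_iff)
  have "sum_list (map (\<lambda>i. Poly_Mapping.single i 1) is) = m \<longleftrightarrow> mset is = mset (content_word m n)"
    unfolding poly_mapping_eq_iff fun_eq_iff lookup_sum_list_single m multiset_eq_iff by blast
  then show ?thesis
    using sorted_content_word[of m n] properties_for_sort sorted_sort_id by metis
qed

lemma Des_iff: "j \<in> Des w \<longleftrightarrow> 1 \<le> j \<and> j < length w \<and> col_ge (w ! (j - 1)) (w ! j)"
  by (auto simp: Des_def col_ge_def)

lemma compatible_iff_Des:
  assumes "length is = length w"
  shows "compatible is w \<longleftrightarrow> (\<forall>j\<in>Des w. is ! (j - 1) < is ! j)"
proof -
  have "compatible is w \<longleftrightarrow> (\<forall>i. Suc i < length w \<longrightarrow> is ! i < is ! Suc i \<or> \<not> col_ge (w ! i) (w ! Suc i))"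
    using assms by (simp add: compatible_def successively_conv_nth)
  also have "\<dots> \<longleftrightarrow> (\<forall>j. 1 \<le> j \<and> j < length w \<and> col_ge (w ! (j - 1)) (w ! j) \<longrightarrow> is ! (j - 1) < is ! j)"
    (is "?L \<longleftrightarrow> ?R")
  proof
    assume L: ?L
    show ?R
    proof (intro allI impI)
      fix j assume "1 \<le> j \<and> j < length w \<and> col_ge (w ! (j - 1)) (w ! j)"
      then show "is ! (j - 1) < is ! j" using L by (cases j) auto
    qed
  next
    assume R: ?R
    show ?L
    proof (intro allI impI)
      fix i assume "Suc i < length w"
      then show "is ! i < is ! Suc i \<or> \<not> col_ge (w ! i) (w ! Suc i)" using R[rule_format, of "Suc i"] by auto
    qed
  qed
  finally show ?thesis by (simp add: Ball_def Des_iff)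
qed

text \<open>The content \<open>m\<close> admits a single sorted index sequence, so the coefficient
  is 0 or 1.\<close>

lemma fundamental_qsym_eq:
  assumes "Poly_Mapping.keys m \<subseteq> {..<n}"
  shows "fundamental_qsym (length w) (Des w) m =
    of_bool (length w = length (content_word m n) \<and> compatible (content_word m n) w)"
proof -
  let ?B = "content_word m n"
  have "length is = length w \<and> sorted is \<and> (\<forall>j\<in>Des w. is ! (j - 1) < is ! j) \<and>
      sum_list (map (\<lambda>i. Poly_Mapping.single i 1) is) = m \<longleftrightarrow>
      is = ?B \<and> length w = length ?B \<and> compatible ?B w" for "is"
    using sorted_content_unique[OF assms, of "is"] compatible_iff_Des[of ?B w] by metis
  then have "{is. length is = length w \<and> sorted is \<and> (\<forall>j\<in>Des w. is ! (j - 1) < is ! j) \<and>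
      sum_list (map (\<lambda>i. Poly_Mapping.single i 1) is) = m} =
      (if length w = length (content_word m n) \<and> compatible (content_word m n) w then {content_word m n} else {})"
    by auto
  then show ?thesis by (simp add: fundamental_qsym_def)
qed

text \<open>The words over the alphabet that contribute at \<open>m\<close> are exactly the
  monomials of the product of complete sums, each with coefficient 1.\<close>

lemma F_series_eq_pairing:
  assumes "\<gamma> \<in> free_alg N" "Poly_Mapping.keys m \<subseteq> {..<n}"
  shows "F_series \<gamma> m =
    pairing (prod_list (map (\<lambda>i. complete_word_sum N (Poly_Mapping.lookup m i)) [0..<n])) \<gamma>"
proof -
  let ?C = "\<lambda>w. length w = length (content_word m n) \<and> compatible (content_word m n) w"
  let ?W = "{w. length w = length (content_word m n) \<and> set w \<subseteq> alphabet N \<and> compatible (content_word m n) w}"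
  have fin: "finite ?W" by (rule finite_words) simp
  have "F_series \<gamma> m = (\<Sum>w\<in>Poly_Mapping.keys \<gamma>. Poly_Mapping.lookup \<gamma> w * of_bool (?C w))"
    by (simp add: F_series_def fundamental_qsym_eq[OF assms(2)])
  also have "\<dots> = (\<Sum>w\<in>Poly_Mapping.keys \<gamma> \<inter> ?W. Poly_Mapping.lookup \<gamma> w)"
    using assms(1) by (intro sum.mono_neutral_cong_right) (auto simp: free_alg_def)
  also have "\<dots> = (\<Sum>w\<in>?W. Poly_Mapping.lookup \<gamma> w)"
    using fin by (intro sum.mono_neutral_left) (auto simp: in_keys_iff)
  finally show ?thesis
    by (simp add: complete_word_sum_product pairing_sum pairing_single)
qed

section \<open>The expansion into Schur functions\<close>

lemma downclosed_conj_part: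
  assumes "\<nu> \<in> partitions"
  shows "r < length \<nu> \<and> c < \<nu> ! r \<longleftrightarrow> r < conj_part \<nu> (Suc c)"
proof -
  let ?A = "{r. r < length \<nu> \<and> Suc c \<le> \<nu> ! r}"
  have "?A = {..<card ?A}"
  proof (rule downclosed_eq_lessThan)
    fix r r' assume r: "r' \<in> ?A" "r < r'"
    then have "\<nu> ! r' \<le> \<nu> ! r"
      using assms sorted_wrt_nth_less[of "(\<ge>)" \<nu> r r'] by (simp add: partitions_def)
    then show "r \<in> ?A" using r by auto
  qed simp
  then have "r \<in> ?A \<longleftrightarrow> r \<in> {..<card ?A}" by (rule arg_cong)
  then show ?thesis by (simp only: conj_part_def mem_Collect_eq lessThan_iff Suc_le_eq)
qed

text \<open>The conjugate partition counted from 0, as cells and matrix entries are.\<close>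

definition columns :: "nat list \<Rightarrow> nat \<Rightarrow> nat" where
  "columns \<nu> c = conj_part \<nu> (Suc c)"

lemma diagram_eq_cells: "\<nu> \<in> partitions \<Longrightarrow> diagram \<nu> = cells (columns \<nu>)"
  using downclosed_conj_part by (auto simp: diagram_def cells_def columns_def)

lemma columns_eq_0:
  assumes "\<nu> \<in> partitions" "first_part \<nu> \<le> c" shows "columns \<nu> c = 0"
proof -
  have "\<not> 0 < conj_part \<nu> (Suc c)"
    using downclosed_conj_part[OF assms(1), of 0 c] assms(2)
    by (cases \<nu>) (auto simp: first_part_def)
  then show ?thesis by (simp add: columns_def)
qed

lemma columns_pos:
  assumes "\<nu> \<in> partitions" "c < first_part \<nu>" shows "0 < columns \<nu> c"
  using downclosed_conj_part[OF assms(1), of 0 c] assms(2)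
  by (cases \<nu>) (auto simp: first_part_def columns_def)

lemma shape_columns: "\<nu> \<in> partitions \<Longrightarrow> shape (columns \<nu>)"
proof -
  assume \<nu>: "\<nu> \<in> partitions"
  have "columns \<nu> c' \<le> columns \<nu> c" if "c \<le> c'" for c c'
    unfolding columns_def conj_part_def using that by (intro card_mono) auto
  moreover have "{c. columns \<nu> c \<noteq> 0} \<subseteq> {..<first_part \<nu>}"
    using columns_eq_0[OF \<nu>] by (force simp: not_less[symmetric])
  ultimately show ?thesis by (auto simp: shape_def antimono_def intro: finite_subset)
qed

text \<open>Conjugation of partitions: \<open>rows\<close> reads off the row lengths, of which there
  are \<open>a 0\<close>.\<close>

lemma bij_betw_columns: "bij_betw columns partitions {a. shape a}"
proof -
  define rows where "rows a = map (\<lambda>r. card {c. r < a c}) [0..<a 0]" for a :: "nat \<Rightarrow> nat"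
  have lower: "c < card {c. r < a c} \<longleftrightarrow> r < a c" if "shape a" for r c and a :: "nat \<Rightarrow> nat"
  proof -
    have "{c. r < a c} = {..<card {c. r < a c}}"
    proof (rule downclosed_eq_lessThan)
      show "finite {c. r < a c}"
        using that by (auto simp: shape_def elim!: finite_subset[rotated])
      show "c \<in> {c. r < a c}" if "c' \<in> {c. r < a c}" "c < c'" for c c'
        using that \<open>shape a\<close> antimonoD[of a c c'] by (simp add: shape_def)
    qed
    then show ?thesis by auto
  qed
  show ?thesis
  proof (rule bij_betw_byWitness[of _ rows])
    show "\<forall>\<nu>\<in>partitions. rows (columns \<nu>) = \<nu>"
    proof
      fix \<nu> assume \<nu>: "\<nu> \<in> partitions"
      note conj = downclosed_conj_part[OF \<nu>, folded columns_def]
      have "r < length \<nu> \<longleftrightarrow> r < columns \<nu> 0" for r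
      proof -
        have "\<nu> ! r \<noteq> 0" if "r < length \<nu>"
          using nth_mem[OF that] \<nu> by (metis (mono_tags, lifting) mem_Collect_eq partitions_def)
        then show ?thesis using conj[of r 0] by blast
      qed
      then have len: "length \<nu> = columns \<nu> 0" by (metis linorder_neqE_nat less_irrefl)
      have "card {c. r < columns \<nu> c} = \<nu> ! r" if "r < length \<nu>" for r
      proof -
        have "{c. r < columns \<nu> c} = {..<\<nu> ! r}" using that conj[of r] by auto
        then show ?thesis by simp
      qed
      then show "rows (columns \<nu>) = \<nu>"
        by (intro nth_equalityI) (auto simp: rows_def len)
    qed
    show "\<forall>a\<in>{a. shape a}. columns (rows a) = a"
    proof
      fix a :: "nat \<Rightarrow> nat" assume "a \<in> {a. shape a}"
      then have a: "shape a" by simp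
      have "a c \<le> a 0" for c using a antimonoD[of a 0 c] by (simp add: shape_def)
      then have le: "r < a c \<Longrightarrow> r < a 0" for r c by (meson less_le_trans)
      have "r < length (rows a) \<and> Suc c \<le> rows a ! r \<longleftrightarrow> r < a c" for r c
        using lower[OF a, of c r] le[of r c] by (cases "r < a 0") (auto simp: rows_def Suc_le_eq)
      then have "{r. r < length (rows a) \<and> Suc c \<le> rows a ! r} = {..<a c}" for c by auto
      then show "columns (rows a) = a"
        by (simp add: fun_eq_iff columns_def conj_part_def)
    qed
    show "columns ` partitions \<subseteq> {a. shape a}" using shape_columns by auto
    show "rows ` {a. shape a} \<subseteq> partitions"
    proof
      fix \<nu> assume "\<nu> \<in> rows ` {a. shape a}"
      then obtain a where a: "shape a" "\<nu> = rows a" by auto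
      have "card {c. r' < a c} \<le> card {c. r < a c}" if "r \<le> r'" for r r'
      proof (rule card_mono)
        show "finite {c. r < a c}"
          using a(1) by (auto simp: shape_def elim!: finite_subset[rotated])
      qed (use that in auto)
      moreover have "card {c. r < a c} \<noteq> 0" if "r < a 0" for r
        using lower[OF a(1), of 0 r] that by linarith
      ultimately show "\<nu> \<in> partitions"
        unfolding a(2) partitions_def rows_def by (force simp: sorted_wrt_iff_nth_less)
    qed
  qed
qed

lemma schur_eq_fillings: "\<nu> \<in> partitions \<Longrightarrow> schur \<nu> m = int (card (fillings (cells (columns \<nu>)) m))"
  unfolding schur_def ssyt_def fillings_def diagram_eq_cells[symmetric]
  by (intro arg_cong[of _ _ "\<lambda>A. int (card A)"]) auto

section \<open>Transfer from the polynomial ring to the quotient\<close>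

abbreviation elem_var :: "nat \<Rightarrow> (nat \<Rightarrow>\<^sub>0 nat) \<Rightarrow>\<^sub>0 int" where
  "elem_var k \<equiv> if k = 0 then 1 else Poly_Mapping.single (Poly_Mapping.single k 1) 1"

interpretation elem_vars: elem_complete elem_var "complete_of_elem elem_var"
  by (rule elem_complete_of_elem) simp

lemma commuting_sequence_elem: "commuting_sequence (\<lambda>k. abs_kron_quot (nc_elem N (int k)))"
  by unfold_locales (rule nc_elem_commute)

context
  fixes N :: nat
begin

interpretation commuting_sequence "\<lambda>k. abs_kron_quot (nc_elem N (int k))"
  by (rule commuting_sequence_elem)

lemma eval_elem_var: "eval_poly (elem_var k) = abs_kron_quot (nc_elem N (int k))"
proof (cases "k = 0")
  case True
  have "nc_elem N 0 = 1" by (simp add: nc_elem_eq)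
  then show ?thesis using True by (simp add: abs_kron_quot_hom)
next
  case False
  then show ?thesis using eval_poly_var[of k] by simp
qed

text \<open>Both sides satisfy the recursion that expresses h_k through the e_i and lower h_j; for
  words it is the vanishing alternating sum.\<close>

lemma eval_complete: "eval_poly (complete_of_elem elem_var k) = abs_kron_quot (complete_word_sum N k)"
proof (induction k rule: less_induct)
  case (less k)
  show ?case
  proof (cases k)
    case 0
    then show ?thesis by (simp add: abs_kron_quot_hom)
  next
    case (Suc n)
    let ?e = "\<lambda>i. abs_kron_quot (nc_elem N (int i))"
    let ?h = "\<lambda>i. abs_kron_quot (complete_word_sum N i)"
    have "(\<Sum>i\<le>Suc n. (- 1) ^ i * (?e i * ?h (Suc n - i))) = 0"
      using chain_sum_alternating[of "alphabet N" "Suc n" col_ge "\<lambda>x. abs_kron_quot (uvar x)"]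
      by (simp add: abs_kron_quot_chain_sum nc_elem_eq)
    moreover have "?e 0 = 1" by (simp add: abs_kron_quot_hom nc_elem_eq)
    ultimately have "?h (Suc n) = (\<Sum>i\<le>n. (- 1) ^ i * (?e (Suc i) * ?h (n - i)))"
      by (subst (asm) sum.atMost_Suc_shift) (simp add: sum_negf)
    moreover have "eval_poly (complete_of_elem elem_var (Suc n)) =
        (\<Sum>i\<le>n. (- 1) ^ i * (?e (Suc i) * ?h (n - i)))"
      unfolding complete_of_elem.simps eval_poly_sum
    proof (rule sum.cong)
      fix i assume "i \<in> {..n}"
      have "eval_poly ((- 1) ^ i) = (- 1) ^ i"
        by (simp add: eval_poly_power eval_poly_uminus)
      then show "eval_poly ((- 1) ^ i * (elem_var (Suc i) * complete_of_elem elem_var (n - i))) =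
          (- 1) ^ i * (?e (Suc i) * ?h (n - i))"
        unfolding eval_poly_mult eval_elem_var using less[of "n - i"] Suc by simp
    qed simp
    ultimately show ?thesis using Suc by simp
  qed
qed

lemma eval_Ez: "eval_poly (elem_vars.Ez z) = abs_kron_quot (nc_elem N z)"
proof (cases "z < 0")
  case True
  then have "nc_elem N z = 0" by (simp add: nc_elem_eq)
  then show ?thesis using True by (simp add: elem_vars.Ez_def abs_kron_quot_hom)
next
  case False
  then show ?thesis using eval_elem_var[of "nat z"] by (simp add: elem_vars.Ez_def)
qed

text \<open>The Leibniz terms are written as ordered products before they are evaluated. Conjugation
  by \<open>Suc\<close> passes to permutations of \<open>{1..t}\<close>, where \<open>t\<close> is
  the first part; it preserves signs and the differences of \<open>p i\<close> and
  \<open>i\<close>.\<close>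

lemma eval_JT_columns:
  "eval_poly (elem_vars.JT (first_part \<nu>) (columns \<nu>)) = abs_kron_quot (nc_schur N \<nu>)"
proof -
  let ?t = "first_part \<nu>"
  let ?q = "\<lambda>p i. abs_kron_quot (nc_elem N (int (conj_part \<nu> i) + int (p i) - int i))"
  have "p i < ?t" if "p permutes {0..<?t}" "i < ?t" for p i
    using permutes_in_image[OF that(1), of i] that(2) by simp
  then have "elem_vars.JT ?t (columns \<nu>) = (\<Sum>p | p permutes {0..<?t}. of_int (sign p) *
      prod_list (map (\<lambda>i. elem_vars.Ez (int (columns \<nu> i) + int (p i) - int i)) [0..<?t]))"
    unfolding elem_vars.JT_def det_def'[OF mat_carrier]
    by (intro sum.cong arg_cong2[of _ _ _ _ "(*)"] refl)
      (auto simp: prod.distinct_set_conv_list[symmetric] intro!: prod.cong)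
  then have "eval_poly (elem_vars.JT ?t (columns \<nu>)) = (\<Sum>p | p permutes {0..<?t}. of_int (sign p) *
      prod_list (map (\<lambda>i. abs_kron_quot (nc_elem N (int (columns \<nu> i) + int (p i) - int i))) [0..<?t]))"
    by (simp add: eval_poly_sum eval_poly_mult eval_poly_prod_list comp_def eval_Ez)
  also have "\<dots> = (\<Sum>\<pi> | \<pi> permutes {1..?t}. of_int (sign \<pi>) * prod_list (map (?q \<pi>) [1..<Suc ?t]))"
  proof (rule sum.reindex_bij_witness[of _ "map_permutation {1..?t} (\<lambda>i. i - 1)" "map_permutation {0..<?t} Suc"])
    have bij: "bij_betw Suc {0..<?t} {1..?t}"
      by (rule bij_betw_byWitness[of _ "\<lambda>i. i - 1"]) auto
    fix p assume "p \<in> {p. p permutes {0..<?t}}"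
    then have p: "p permutes {0..<?t}" by simp
    show "map_permutation {1..?t} (\<lambda>i. i - 1) (map_permutation {0..<?t} Suc p) = p"
      by (rule map_permutation_compose_inv[OF bij p]) simp
    show "map_permutation {0..<?t} Suc p \<in> {\<pi>. \<pi> permutes {1..?t}}"
      using map_permutation_permutes[OF bij p] by simp
    have "map_permutation {0..<?t} Suc p (Suc i) = Suc (p i)" if "i < ?t" for i
      using that by (intro map_permutation_apply) auto
    then have "map (?q (map_permutation {0..<?t} Suc p)) [1..<Suc ?t] =
        map (\<lambda>i. abs_kron_quot (nc_elem N (int (columns \<nu> i) + int (p i) - int i))) [0..<?t]"
      unfolding One_nat_def map_Suc_upt[symmetric] by (simp add: columns_def add_diff_eq)
    moreover have "sign (map_permutation {0..<?t} Suc p) = sign p"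
      using p by (intro sign_map_permutation) auto
    ultimately show "of_int (sign (map_permutation {0..<?t} Suc p)) *
        prod_list (map (?q (map_permutation {0..<?t} Suc p)) [1..<Suc ?t]) =
        of_int (sign p) *
        prod_list (map (\<lambda>i. abs_kron_quot (nc_elem N (int (columns \<nu> i) + int (p i) - int i))) [0..<?t])"
      by simp
  next
    have bij: "bij_betw (\<lambda>i. i - 1) {1..?t} {0..<?t}"
      by (rule bij_betw_byWitness[of _ Suc]) auto
    fix \<pi> assume "\<pi> \<in> {\<pi>. \<pi> permutes {1..?t}}"
    then have \<pi>: "\<pi> permutes {1..?t}" by simp
    show "map_permutation {0..<?t} Suc (map_permutation {1..?t} (\<lambda>i. i - 1) \<pi>) = \<pi>"
      by (rule map_permutation_compose_inv[OF bij \<pi>]) simp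
    show "map_permutation {1..?t} (\<lambda>i. i - 1) \<pi> \<in> {p. p permutes {0..<?t}}"
      using map_permutation_permutes[OF bij \<pi>] by simp
  qed
  also have "\<dots> = abs_kron_quot (nc_schur N \<nu>)"
    by (simp add: nc_schur_def abs_kron_quot_sum abs_kron_quot_hom abs_kron_quot_of_int
        abs_kron_quot_prod_list comp_def del: upt_Suc)
  finally show ?thesis .
qed

text \<open>The product is taken in a commutative ring over an unordered set, so the coefficient
  depends only on the multiset of exponents. This gives symmetry, and with the expansion of the
  product also the Schur coefficients.\<close>

lemma F_series_eq_of_complete_prod:
  assumes "\<gamma> \<in> kron_perp N"
    and "abs_kron_quot f = eval_poly (\<Prod>i\<in>Poly_Mapping.keys m. complete_of_elem elem_var (Poly_Mapping.lookup m i))"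
  shows "F_series \<gamma> m = pairing f \<gamma>"
proof -
  define n where "n = Poly_Mapping.degree m"
  have keys: "Poly_Mapping.keys m \<subseteq> {..<n}"
    using in_keys_less_degree by (auto simp: n_def)
  have "(\<Prod>i\<in>Poly_Mapping.keys m. complete_of_elem elem_var (Poly_Mapping.lookup m i)) =
      (\<Prod>i\<in>set [0..<n]. complete_of_elem elem_var (Poly_Mapping.lookup m i))"
    using keys by (intro prod.mono_neutral_left) (auto simp: in_keys_iff)
  also have "\<dots> = prod_list (map (\<lambda>i. complete_of_elem elem_var (Poly_Mapping.lookup m i)) [0..<n])"
    by (rule prod.distinct_set_conv_list) simp
  finally have "abs_kron_quot f =
      abs_kron_quot (prod_list (map (\<lambda>i. complete_word_sum N (Poly_Mapping.lookup m i)) [0..<n]))"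
    using assms(2) by (simp add: eval_poly_prod_list abs_kron_quot_prod_list comp_def eval_complete)
  moreover have "\<gamma> \<in> free_alg N" using assms(1) by (simp add: kron_perp_def)
  ultimately show ?thesis
    using F_series_eq_pairing[OF _ keys] pairing_cong_kron[OF assms(1)] by metis
qed

end

theorem theorem2p5:
  fixes N :: nat and \<gamma> :: ncpoly
  assumes "N \<ge> 1"
    and "\<gamma> \<in> kron_perp N"
  shows "symmetric_series (F_series \<gamma>) \<and>
    (\<forall>m. ((\<lambda>\<nu>. schur \<nu> m * pairing (nc_schur N \<nu>) \<gamma>) has_sum F_series \<gamma> m) partitions)"
proof (intro conjI allI)
  interpret commuting_sequence "\<lambda>k. abs_kron_quot (nc_elem N (int k))"
    by (rule commuting_sequence_elem)
  let ?H = "complete_of_elem elem_var"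
  let ?P = "\<lambda>m. \<Prod>i\<in>Poly_Mapping.keys m. ?H (Poly_Mapping.lookup m i)"
  note F = F_series_eq_of_complete_prod[OF assms(2)]
  show "symmetric_series (F_series \<gamma>)"
    unfolding symmetric_series_def
  proof (intro allI impI)
    fix \<sigma> :: "nat \<Rightarrow> nat" and m :: "nat \<Rightarrow>\<^sub>0 nat"
    assume \<sigma>: "bij \<sigma>"
    then have inj: "inj \<sigma>" by (rule bij_is_inj)
    have "bij_betw \<sigma> (Poly_Mapping.keys (Poly_Mapping.map_key \<sigma> m)) (Poly_Mapping.keys m)"
      unfolding keys_map_key[OF inj] using \<sigma>
      by (metis bij_betw_subset bij_is_surj surj_image_vimage_eq top_greatest)
    then have "?P m = (\<Prod>i\<in>Poly_Mapping.keys (Poly_Mapping.map_key \<sigma> m). ?H (Poly_Mapping.lookup m (\<sigma> i)))"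
      by (rule prod.reindex_bij_betw[symmetric])
    then have eq: "?P m = ?P (Poly_Mapping.map_key \<sigma> m)"
      by (simp only: map_key.rep_eq[OF inj] comp_apply)
    \<comment> \<open>One representative \<open>f\<close> serves both exponent vectors, whose
      coefficients are then the same pairing.\<close>
    obtain f where f: "eval_poly (?P m) = abs_kron_quot f"
      by (rule abs_kron_quot_cases)
    show "F_series \<gamma> (Poly_Mapping.map_key \<sigma> m) = F_series \<gamma> m"
      using F[OF f[symmetric]] F[OF f[symmetric, unfolded eq]] by (rule trans[OF _ sym, rotated])
  qed
  fix m :: "nat \<Rightarrow>\<^sub>0 nat"
  \<comment> \<open>\<open>total m\<close> bounds the square containing all contributing shapes, and
    \<open>Poly_Mapping.degree m\<close> bounds the indices of the variables.\<close>
  define d where "d = max (total m) (Poly_Mapping.degree m)"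
  let ?K = "\<lambda>a. card (fillings (cells a) m)"
  define B where "B = {\<nu> \<in> partitions. columns \<nu> \<in> bounded_shapes d}"
  have bij: "bij_betw columns B (bounded_shapes d)"
  proof (rule bij_betw_imageI)
    show "inj_on columns B"
      using bij_betw_imp_inj_on[OF bij_betw_columns] by (rule inj_on_subset) (auto simp: B_def)
    show "columns ` B = bounded_shapes d"
    proof
      show "bounded_shapes d \<subseteq> columns ` B"
      proof
        fix a assume a: "a \<in> bounded_shapes d"
        then have "a \<in> columns ` partitions"
          using bounded_shapes_shape by (simp add: bij_betw_imp_surj_on[OF bij_betw_columns])
        then show "a \<in> columns ` B" using a by (auto simp: B_def)
      qed
    qed (auto simp: B_def)
  qed
  have finB: "finite B"
    using bij finite_bounded_shapes bij_betw_finite by blast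
  have keys: "Poly_Mapping.keys m \<subseteq> {..<d}"
    using in_keys_less_degree by (fastforce simp: d_def)
  \<comment> \<open>The expansion uses determinants of the common size \<open>d\<close>, while
    \<open>nc_schur\<close> uses the size \<open>first_part \<nu>\<close>.\<close>
  have JT: "elem_vars.JT d (columns \<nu>) = elem_vars.JT (first_part \<nu>) (columns \<nu>)" if "\<nu> \<in> B" for \<nu>
  proof (rule elem_vars.JT_stable)
    show "first_part \<nu> \<le> d"
      using that columns_pos[of \<nu> d] by (fastforce simp: B_def bounded_shapes_def not_less[symmetric])
  qed (use that columns_eq_0 in \<open>auto simp: B_def\<close>)
  have "?P m = (\<Prod>i<d. ?H (Poly_Mapping.lookup m i))"
    using keys by (intro prod.mono_neutral_left) (auto simp: in_keys_iff)
  also have "\<dots> = (\<Sum>a\<in>bounded_shapes d. of_nat (?K a) * elem_vars.JT d a)"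
    using keys by (intro elem_vars.complete_expansion[symmetric]) (auto simp: d_def)
  also have "\<dots> = (\<Sum>\<nu>\<in>B. of_nat (?K (columns \<nu>)) * elem_vars.JT d (columns \<nu>))"
    by (rule sum.reindex_bij_betw[OF bij, symmetric])
  also have "\<dots> = (\<Sum>\<nu>\<in>B. of_int (schur \<nu> m) * elem_vars.JT (first_part \<nu>) (columns \<nu>))"
    by (intro sum.cong) (auto simp: JT B_def schur_eq_fillings)
  finally have "F_series \<gamma> m = pairing (\<Sum>\<nu>\<in>B. of_int (schur \<nu> m) * nc_schur N \<nu>) \<gamma>"
    by (intro F) (simp add: eval_poly_sum eval_poly_mult eval_JT_columns abs_kron_quot_sum
      abs_kron_quot_hom abs_kron_quot_of_int)
  also have "\<dots> = (\<Sum>\<nu>\<in>B. schur \<nu> m * pairing (nc_schur N \<nu>) \<gamma>)"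
    by (simp add: pairing_sum pairing_of_int_mult)
  finally have sum: "F_series \<gamma> m = (\<Sum>\<nu>\<in>B. schur \<nu> m * pairing (nc_schur N \<nu>) \<gamma>)" .
  show "((\<lambda>\<nu>. schur \<nu> m * pairing (nc_schur N \<nu>) \<gamma>) has_sum F_series \<gamma> m) partitions"
  proof (rule has_sum_finite_neutralI[OF finB _ _ sum])
    show "B \<subseteq> partitions" by (auto simp: B_def)
    fix \<nu> assume \<nu>: "\<nu> \<in> partitions - B"
    have "fillings (cells (columns \<nu>)) m = {}"
    proof (rule ccontr)
      assume "fillings (cells (columns \<nu>)) m \<noteq> {}"
      then have "columns \<nu> \<in> bounded_shapes (total m)"
        using fillings_bounded[OF shape_columns] \<nu> by blast
      then have "columns \<nu> \<in> bounded_shapes d"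
        by (auto simp: bounded_shapes_def d_def le_max_iff_disj)
      then show False using \<nu> by (simp add: B_def)
    qed
    then show "schur \<nu> m * pairing (nc_schur N \<nu>) \<gamma> = 0"
      using \<nu> by (simp add: schur_eq_fillings)
  qed
qed

end
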